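(* Let $H$ be a pro-$2$ group and let $n\geq 1$ be an integer. Then the following statements hold. (i) If $H/Z_{n-1}(H)$ is powerful, then the closure $\overline{\gamma_n(H)}$ of the $n$th term of the lower central series of $H$ is powerfully embedded in $H$. (ii) If $H/Z_{n-1}(H)$ is powerful, then the $n$th term $P_n(H)$ of the lower $2$-series (Lazard series) of $H$ is powerful.
   Context: For a subgroup $N$ of a group, $N^k$ denotes the subgroup generated by all $k$th powers of elements of $N$; bars denote topological closure; $[A,B]$ is the subgroup generated by all commutators $[a,b]$, $a\in A$, $b\in B$. A pro-$2$ group $H$ is powerful if $[H,H]\leqslant \overline{H^4}$. A closed normal subgroup $N$ of a pro-$2$ group $H$ is powerfully embedded in $H$ if $[N,H]\leqslant \overline{N^4}$. $\gamma_1(H)=H$, $\gamma_{n+1}(H)=[\gamma_n(H),H]$ is the lower central series. $Z_n(H)$ is the $n$th center: $Z_0(H)=1$ and $Z_{n}(H)/Z_{n-1}(H)=Z(H/Z_{n-1}(H))$. For a pro-$p$ group (here $p=2$) the lower $p$-series is $P_1(H)=H$, $P_n(H)=\overline{P_{n-1}(H)^p}\;\overline{[P_{n-1}(H),H]}$ for $n>1$. *)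

theory Defs
  imports "HOL-Analysis.Analysis" "HOL-Algebra.Generated_Groups" "HOL-Computational_Algebra.Primes"
begin

text \<open>A topological group is a HOL-Algebra group \<open>G\<close> together with an abstract topology \<open>T\<close> on
  its carrier.\<close>

definition topological_group :: "('a, 'b) monoid_scheme \<Rightarrow> 'a topology \<Rightarrow> bool" where
  "topological_group G T \<longleftrightarrow>
     group G \<and> topspace T = carrier G \<and>
     continuous_map (prod_topology T T) T (\<lambda>(x, y). x \<otimes>\<^bsub>G\<^esub> y) \<and>
     continuous_map T T (\<lambda>x. inv\<^bsub>G\<^esub> x)"

definition profinite_group :: "('a, 'b) monoid_scheme \<Rightarrow> 'a topology \<Rightarrow> bool" where
  "profinite_group G T \<longleftrightarrow>
     topological_group G T \<and> compact_space T \<and> Hausdorff_space T \<and>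
     (\<forall>U. openin T U \<and> \<one>\<^bsub>G\<^esub> \<in> U \<longrightarrow> (\<exists>K. subgroup K G \<and> openin T K \<and> K \<subseteq> U))"

text \<open>The index of a subgroup of infinite index is \<open>0\<close> under \<^const>\<open>card\<close>, hence not a power of
  \<open>p\<close>; by compactness it does not occur anyway.\<close>

definition pro_p_group :: "nat \<Rightarrow> ('a, 'b) monoid_scheme \<Rightarrow> 'a topology \<Rightarrow> bool" where
  "pro_p_group p G T \<longleftrightarrow>
     prime p \<and> profinite_group G T \<and>
     (\<forall>N. N \<lhd> G \<and> openin T N \<longrightarrow> (\<exists>k. card (rcosets\<^bsub>G\<^esub> N) = p ^ k))"

definition quotient_topology :: "'a topology \<Rightarrow> ('a \<Rightarrow> 'c) \<Rightarrow> 'c topology" where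
  "quotient_topology X f =
     topology (\<lambda>U. U \<subseteq> f ` topspace X \<and> openin X {x \<in> topspace X. f x \<in> U})"

lemma openin_quotient_topology:
  "openin (quotient_topology X f) U \<longleftrightarrow>
     U \<subseteq> f ` topspace X \<and> openin X {x \<in> topspace X. f x \<in> U}"
proof -
  have "istopology (\<lambda>U. U \<subseteq> f ` topspace X \<and> openin X {x \<in> topspace X. f x \<in> U})"
    unfolding istopology_def
  proof (intro conjI allI impI)
    fix S U
    assume "S \<subseteq> f ` topspace X \<and> openin X {x \<in> topspace X. f x \<in> S}"
      and "U \<subseteq> f ` topspace X \<and> openin X {x \<in> topspace X. f x \<in> U}"
    moreover have "{x \<in> topspace X. f x \<in> S \<inter> U}
        = {x \<in> topspace X. f x \<in> S} \<inter> {x \<in> topspace X. f x \<in> U}" by blast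
    ultimately show "S \<inter> U \<subseteq> f ` topspace X" "openin X {x \<in> topspace X. f x \<in> S \<inter> U}"
      by auto
  next
    fix \<K>
    assume K: "\<forall>K\<in>\<K>. K \<subseteq> f ` topspace X \<and> openin X {x \<in> topspace X. f x \<in> K}"
    then show "\<Union>\<K> \<subseteq> f ` topspace X" by blast
    have "{x \<in> topspace X. f x \<in> \<Union>\<K>} = (\<Union>K\<in>\<K>. {x \<in> topspace X. f x \<in> K})" by blast
    with K show "openin X {x \<in> topspace X. f x \<in> \<Union>\<K>}" by auto
  qed
  then show ?thesis
    by (simp add: quotient_topology_def topology_inverse')
qed

lemma topspace_quotient_topology: "topspace (quotient_topology X f) = f ` topspace X"
proof
  show "topspace (quotient_topology X f) \<subseteq> f ` topspace X"
    by (rule openin_quotient_topology[THEN iffD1, OF openin_topspace, THEN conjunct1])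
  have "{x \<in> topspace X. f x \<in> f ` topspace X} = topspace X" by auto
  then have "openin (quotient_topology X f) (f ` topspace X)"
    by (simp add: openin_quotient_topology)
  then show "f ` topspace X \<subseteq> topspace (quotient_topology X f)" by (rule openin_subset)
qed

lemma quotient_map_quotient_topology: "quotient_map X (quotient_topology X f) f"
  by (auto simp: quotient_map_def topspace_quotient_topology openin_quotient_topology)

text \<open>The topology of the topological quotient group \<open>G Mod N\<close>.\<close>

definition Mod_topology :: "('a, 'b) monoid_scheme \<Rightarrow> 'a topology \<Rightarrow> 'a set \<Rightarrow> 'a set topology" where
  "Mod_topology G T N = quotient_topology T (\<lambda>x. N #>\<^bsub>G\<^esub> x)"

definition power_subgroup :: "('a, 'b) monoid_scheme \<Rightarrow> 'a set \<Rightarrow> nat \<Rightarrow> 'a set" where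
  "power_subgroup G N k = generate G ((\<lambda>x. x [^]\<^bsub>G\<^esub> k) ` N)"

text \<open>The commutator convention \<open>[a, b] = a b a\<^sup>-\<^sup>1 b\<^sup>-\<^sup>1\<close> is that of \<^const>\<open>derived\<close>. For subgroups
  \<open>A\<close> and \<open>B\<close> the other usual convention \<open>a\<^sup>-\<^sup>1 b\<^sup>-\<^sup>1 a b\<close> gives the same subgroup.\<close>

definition commutator_subgroup :: "('a, 'b) monoid_scheme \<Rightarrow> 'a set \<Rightarrow> 'a set \<Rightarrow> 'a set" where
  "commutator_subgroup G A B =
     generate G (\<Union>a\<in>A. \<Union>b\<in>B. {a \<otimes>\<^bsub>G\<^esub> b \<otimes>\<^bsub>G\<^esub> inv\<^bsub>G\<^esub> a \<otimes>\<^bsub>G\<^esub> inv\<^bsub>G\<^esub> b})"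

text \<open>The next two notions are meant for a pro-2 group \<open>(G, T)\<close>.\<close>

definition powerful :: "('a, 'b) monoid_scheme \<Rightarrow> 'a topology \<Rightarrow> bool" where
  "powerful G T \<longleftrightarrow>
     commutator_subgroup G (carrier G) (carrier G) \<subseteq> T closure_of (power_subgroup G (carrier G) 4)"

definition powerfully_embedded :: "'a set \<Rightarrow> ('a, 'b) monoid_scheme \<Rightarrow> 'a topology \<Rightarrow> bool" where
  "powerfully_embedded N G T \<longleftrightarrow>
     N \<lhd> G \<and> closedin T N \<and>
     commutator_subgroup G N (carrier G) \<subseteq> T closure_of (power_subgroup G N 4)"

text \<open>The lower central series and the lower \<open>p\<close>-series start at index \<open>1\<close>; the value at \<open>0\<close> is a
  dummy.\<close>

fun lower_central :: "('a, 'b) monoid_scheme \<Rightarrow> nat \<Rightarrow> 'a set" where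
  "lower_central G 0 = carrier G"
| "lower_central G (Suc 0) = carrier G"
| "lower_central G (Suc (Suc n)) = commutator_subgroup G (lower_central G (Suc n)) (carrier G)"

fun lower_p_series :: "nat \<Rightarrow> ('a, 'b) monoid_scheme \<Rightarrow> 'a topology \<Rightarrow> nat \<Rightarrow> 'a set" where
  "lower_p_series p G T 0 = carrier G"
| "lower_p_series p G T (Suc 0) = carrier G"
| "lower_p_series p G T (Suc (Suc n)) =
     (T closure_of (power_subgroup G (lower_p_series p G T (Suc n)) p)) <#>\<^bsub>G\<^esub>
     (T closure_of (commutator_subgroup G (lower_p_series p G T (Suc n)) (carrier G)))"

definition group_center :: "('a, 'b) monoid_scheme \<Rightarrow> 'a set" where
  "group_center G = {z \<in> carrier G. \<forall>x\<in>carrier G. z \<otimes>\<^bsub>G\<^esub> x = x \<otimes>\<^bsub>G\<^esub> z}"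

primrec nth_center :: "('a, 'b) monoid_scheme \<Rightarrow> nat \<Rightarrow> 'a set" where
  "nth_center G 0 = {\<one>\<^bsub>G\<^esub>}"
| "nth_center G (Suc n) =
     {x \<in> carrier G. nth_center G n #>\<^bsub>G\<^esub> x \<in> group_center (G Mod nth_center G n)}"

end

(* Write G for the group, C(L) for the centre of G modulo a normal subgroup L, and S(r,k) for the
   product of the groups gamma_(k+i)^(2^(r-i)), 0 <= i <= r. Induction on r, using
   [y^2, g] = [y, c] c^2 for c = [y, g], gives [S(r,k), G] <= S(r,k+1) and S(r,k)^2 <= S(r+1,k).

   (i) Work modulo an open normal subgroup N. Every fourth power lies in S(2,1), which is contained
   in the (n-1)-fold iterate of C at S(2,n), and so is Z_(n-1). As G/Z_(n-1) is powerful, the same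
   holds for [G,G], whence gamma_(n+1) <= S(2,n) = gamma_n^4 gamma_(n+1)^2 gamma_(n+2). The last two
   factors are absorbed by a Nakayama argument in the finite 2-group G/N.

   (ii) Modulo N, P_n <= S(n-1,1), and for n >= 2 the centralizer of S(n-1,1) modulo S(n+1,1)
   contains all squares, hence all of P_2 >= P_n. So [P_n,P_n] <= S(n+1,1); its factors
   gamma_k^(2^(n+2-k)) with k <= n lie in P_n^4 because gamma_k^(2^(n-k)) does in P_n, and the
   others lie in gamma_(n+1) <= gamma_n^4 N by (i). *)

theory Submission
  imports Defs "HOL-Algebra.SndIsomorphismGrp" "HOL-Algebra.Group_Action" "HOL-Algebra.Sylow"
    "HOL-Algebra.Multiplicative_Group"
begin

section \<open>Centralizers modulo a normal subgroup\<close>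

text \<open>A power gamma_k^(2^r) alone is not stable under commutation: [y^2, g] contains, beside
  c^2, the correction [y, c], which has gone one more step down the central series but gained no
  squaring. S(r,k) is built to admit this exchange of a squaring for a step, in the form S(r,k+1) <=
  S(r+1,k).

  The exponent 4 is what makes (i) work: beyond gamma_n^4, the factors of S(2,n) are made of squares
  of gamma_(n+1) and of commutators of gamma_(n+1) with G, just what Nakayama removes from
  gamma_(n+1); S(1,n) = gamma_n^2 gamma_(n+1) would leave gamma_(n+1) itself. In (ii) the same 4 is
  the distance of two squarings between S(n-1,1) and S(n+1,1).

  Reduction modulo N does not pass to G/N: N is multiplied into every term, giving the central
  series N gamma_k. Its mixed powers contain N, so they are open, hence closed, and can bound the
  closures that occur in P_n. Inclusions [A,G] <= L are written A <= \<open>center_mod G L\<close>;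
  the right side is a subgroup, so it is enough to check generators of A.\<close>

definition centralizer_mod :: "('a, 'b) monoid_scheme \<Rightarrow> 'a set \<Rightarrow> 'a set \<Rightarrow> 'a set" where
  "centralizer_mod G Y L =
     {x \<in> carrier G. \<forall>y\<in>Y. x \<otimes>\<^bsub>G\<^esub> y \<otimes>\<^bsub>G\<^esub> inv\<^bsub>G\<^esub> x \<otimes>\<^bsub>G\<^esub> inv\<^bsub>G\<^esub> y \<in> L}"

text \<open>For normal \<open>L\<close> this is the preimage of Z(G/L), so iterating it climbs the
  upper central series above \<open>L\<close>.\<close>

abbreviation center_mod :: "('a, 'b) monoid_scheme \<Rightarrow> 'a set \<Rightarrow> 'a set" where
  "center_mod G L \<equiv> centralizer_mod G (carrier G) L"

text \<open>The preimage of the elements of order at most 2 in Z(G/L). It contains \<open>M\<close>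
  exactly when \<open>L\<close> contains [M,G] and all squares of elements of
  \<open>M\<close>.\<close>

definition exp2_center_mod :: "('a, 'b) monoid_scheme \<Rightarrow> 'a set \<Rightarrow> 'a set" where
  "exp2_center_mod G L = {x \<in> center_mod G L. x \<otimes>\<^bsub>G\<^esub> x \<in> L}"

context group
begin

abbreviation commutator :: "'a \<Rightarrow> 'a \<Rightarrow> 'a" where
  "commutator x y \<equiv> x \<otimes> y \<otimes> inv x \<otimes> inv y"

lemma inv_mult_cancel:
  assumes "x \<in> carrier G" "y \<in> carrier G"
  shows "inv x \<otimes> (x \<otimes> y) = y" "x \<otimes> (inv x \<otimes> y) = y"
  using assms by (simp_all add: m_assoc[symmetric])

text \<open>Inverses are pushed to the letters, products are associated to the right and neighbours
  cancel, so with the default rules both sides of an identity between words become reduced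
  words.\<close>

lemmas group_word_simps = m_assoc inv_mult_group inv_mult_cancel

lemma inv_commutator:
  assumes "x \<in> carrier G" "y \<in> carrier G"
  shows "inv (commutator x y) = commutator y x"
  using assms by (simp add: group_word_simps)

lemma normal_conj:
  assumes "L \<lhd> G" "x \<in> L" "g \<in> carrier G"
  shows "g \<otimes> x \<otimes> inv g \<in> L"
  by (rule normal.inv_op_closed2[OF assms(1,3,2)])

lemma normal_commutator:
  assumes "L \<lhd> G" "x \<in> L" "g \<in> carrier G"
  shows "commutator x g \<in> L" "commutator g x \<in> L"
proof -
  interpret L: normal L G by fact
  have x: "x \<in> carrier G" using assms(2) by (rule L.mem_carrier)
  have "x \<otimes> (g \<otimes> inv x \<otimes> inv g) \<in> L"
    using assms by (intro L.m_closed normal_conj L.m_inv_closed)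
  then show "commutator x g \<in> L" using x assms(3) by (simp add: group_word_simps)
  then have "inv (commutator x g) \<in> L" by (rule L.m_inv_closed)
  then show "commutator g x \<in> L" using x assms(3) by (simp add: inv_commutator)
qed

lemma centralizer_mod_carrier: "centralizer_mod G Y L \<subseteq> carrier G"
  by (auto simp: centralizer_mod_def)

lemma centralizer_mod_mono: "L \<subseteq> L' \<Longrightarrow> centralizer_mod G Y L \<subseteq> centralizer_mod G Y L'"
  by (auto simp: centralizer_mod_def)

text \<open>By [x^-1, y] = x^-1 [x, y]^-1 x and [x x', y] = x [x', y] x^-1 [x, y]. Only the first
  argument varies, so \<open>Y\<close> can be any subset.\<close>

lemma subgroup_centralizer_mod:
  assumes "L \<lhd> G" "Y \<subseteq> carrier G"
  shows "subgroup (centralizer_mod G Y L) G"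
proof -
  interpret L: normal L G by fact
  show ?thesis
  proof (rule subgroupI)
    show "centralizer_mod G Y L \<subseteq> carrier G" by (rule centralizer_mod_carrier)
    have "\<one> \<in> centralizer_mod G Y L" using assms(2) by (auto simp: centralizer_mod_def subset_iff)
    then show "centralizer_mod G Y L \<noteq> {}" by blast
  next
    fix x assume x: "x \<in> centralizer_mod G Y L"
    then have xc: "x \<in> carrier G" by (simp add: centralizer_mod_def)
    have "commutator (inv x) y \<in> L" if y: "y \<in> Y" for y
    proof -
      have yc: "y \<in> carrier G" using assms(2) y by blast
      have "inv x \<otimes> inv (commutator x y) \<otimes> inv (inv x) \<in> L"
        using x y by (intro normal_conj[OF assms(1)] L.m_inv_closed) (auto simp: centralizer_mod_def)
      then show ?thesis using xc yc by (simp add: group_word_simps)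
    qed
    then show "inv x \<in> centralizer_mod G Y L" using xc by (simp add: centralizer_mod_def)
  next
    fix x x' assume x: "x \<in> centralizer_mod G Y L" and x': "x' \<in> centralizer_mod G Y L"
    then have xc: "x \<in> carrier G" "x' \<in> carrier G" by (simp_all add: centralizer_mod_def)
    have "commutator (x \<otimes> x') y \<in> L" if y: "y \<in> Y" for y
    proof -
      have yc: "y \<in> carrier G" using assms(2) y by blast
      have "commutator x' y \<in> L" "commutator x y \<in> L"
        using x x' y by (simp_all add: centralizer_mod_def)
      then have "x \<otimes> commutator x' y \<otimes> inv x \<otimes> commutator x y \<in> L"
        using normal_conj[OF assms(1) _ xc(1)] by blast
      then show ?thesis using xc yc by (simp add: group_word_simps)
    qed
    then show "x \<otimes> x' \<in> centralizer_mod G Y L" using xc by (simp add: centralizer_mod_def)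
  qed
qed

lemma subset_centralizer_mod:
  assumes "L \<lhd> G" "Y \<subseteq> carrier G"
  shows "L \<subseteq> centralizer_mod G Y L"
proof
  fix x assume x: "x \<in> L"
  then have "x \<in> carrier G" by (rule subgroup.mem_carrier[OF normal_imp_subgroup[OF assms(1)]])
  then show "x \<in> centralizer_mod G Y L"
    using normal_commutator(1)[OF assms(1) x] assms(2) by (auto simp: centralizer_mod_def)
qed

lemmas subset_center_mod = subset_centralizer_mod[OF _ order_refl]

text \<open>Conjugation moves to the second argument, [g x g^-1, y] = g [x, g^-1 y g] g^-1, and
  there it permutes the whole group.\<close>

lemma normal_center_mod:
  assumes "L \<lhd> G"
  shows "center_mod G L \<lhd> G"
proof (rule normal_invI[OF subgroup_centralizer_mod[OF assms order_refl]])
  fix g x assume g: "g \<in> carrier G" and x: "x \<in> center_mod G L"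
  then have xc: "x \<in> carrier G" by (simp add: centralizer_mod_def)
  have "commutator (g \<otimes> x \<otimes> inv g) y \<in> L" if y: "y \<in> carrier G" for y
  proof -
    have "g \<otimes> commutator x (inv g \<otimes> y \<otimes> g) \<otimes> inv g \<in> L"
      using x y g by (intro normal_conj[OF assms]) (auto simp: centralizer_mod_def)
    then show ?thesis using xc y g by (simp add: group_word_simps)
  qed
  then show "g \<otimes> x \<otimes> inv g \<in> center_mod G L" using xc g by (simp add: centralizer_mod_def)
qed

text \<open>The two clauses of \<open>exp2_center_mod\<close> match the two factors in [y^2, g] =
  [y, c] c^2: centrality modulo \<open>L\<close> handles [y, c] and the exponent handles
  c^2.\<close>

lemma square_commutator_mem:
  assumes L: "L \<lhd> G" and y: "y \<in> carrier G" and g: "g \<in> carrier G"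
    and c: "commutator y g \<in> exp2_center_mod G L"
  shows "commutator (y \<otimes> y) g \<in> L"
proof -
  interpret L: normal L G by fact
  define c' where "c' = commutator y g"
  have "commutator c' y \<in> L" "c' \<otimes> c' \<in> L"
    using c y unfolding c'_def exp2_center_mod_def centralizer_mod_def by auto
  then have "inv (commutator c' y) \<otimes> (c' \<otimes> c') \<in> L" by blast
  moreover have "inv (commutator c' y) \<otimes> (c' \<otimes> c') = commutator (y \<otimes> y) g"
    using y g by (simp add: c'_def group_word_simps)
  ultimately show ?thesis by simp
qed

text \<open>Squaring is multiplicative here up to \<open>L\<close>: (x y)^2 = x^2 [x^-1, y] y^2, and
  the middle factor lies in \<open>L\<close> by centrality.\<close>

lemma normal_exp2_center_mod:
  assumes "L \<lhd> G"
  shows "exp2_center_mod G L \<lhd> G"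
proof -
  interpret L: normal L G by fact
  interpret C: normal "center_mod G L" G by (rule normal_center_mod[OF assms])
  have "subgroup (exp2_center_mod G L) G"
  proof (rule subgroupI)
    show "exp2_center_mod G L \<subseteq> carrier G" by (auto simp: exp2_center_mod_def)
    have "\<one> \<in> exp2_center_mod G L" by (auto simp: exp2_center_mod_def)
    then show "exp2_center_mod G L \<noteq> {}" by blast
  next
    fix x assume x: "x \<in> exp2_center_mod G L"
    then have xc: "x \<in> carrier G" by (simp add: exp2_center_mod_def)
    have "inv (x \<otimes> x) \<in> L" using x by (intro L.m_inv_closed) (simp add: exp2_center_mod_def)
    then show "inv x \<in> exp2_center_mod G L"
      using x xc by (simp add: exp2_center_mod_def inv_mult_group)
  next
    fix x y assume x: "x \<in> exp2_center_mod G L" and y: "y \<in> exp2_center_mod G L"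
    then have c: "x \<in> carrier G" "y \<in> carrier G" by (simp_all add: exp2_center_mod_def)
    have "x \<in> center_mod G L" using x unfolding exp2_center_mod_def by blast
    then have "inv x \<in> center_mod G L" by (rule C.m_inv_closed)
    then have "commutator (inv x) y \<in> L" using c unfolding centralizer_mod_def by blast
    moreover have "x \<otimes> x \<in> L" "y \<otimes> y \<in> L"
      using x y by (simp_all add: exp2_center_mod_def)
    ultimately have "(x \<otimes> x) \<otimes> commutator (inv x) y \<otimes> (y \<otimes> y) \<in> L" by blast
    then have "(x \<otimes> y) \<otimes> (x \<otimes> y) \<in> L" using c by (simp add: group_word_simps)
    then show "x \<otimes> y \<in> exp2_center_mod G L" using x y by (simp add: exp2_center_mod_def)
  qed
  then show ?thesis
  proof (rule normal_invI)
    fix g x assume g: "g \<in> carrier G" and x: "x \<in> exp2_center_mod G L"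
    then have xc: "x \<in> carrier G" by (simp add: exp2_center_mod_def)
    have "g \<otimes> (x \<otimes> x) \<otimes> inv g \<in> L"
      using x g by (intro normal_conj[OF assms]) (auto simp: exp2_center_mod_def)
    then have "(g \<otimes> x \<otimes> inv g) \<otimes> (g \<otimes> x \<otimes> inv g) \<in> L"
      using xc g by (simp add: group_word_simps)
    then show "g \<otimes> x \<otimes> inv g \<in> exp2_center_mod G L"
      using x g normal_conj[OF C.normal_axioms] by (simp add: exp2_center_mod_def)
  qed
qed

lemma subset_exp2_center_mod:
  assumes "L \<lhd> G"
  shows "L \<subseteq> exp2_center_mod G L"
  using subset_center_mod[OF assms] subgroup.m_closed[OF normal_imp_subgroup[OF assms]]
  by (simp add: exp2_center_mod_def subset_iff)

lemma normal_center_mod_iter: "L \<lhd> G \<Longrightarrow> (center_mod G ^^ i) L \<lhd> G"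
  by (induction i) (auto intro: normal_center_mod)

lemma center_mod_iter_mono: "L \<subseteq> L' \<Longrightarrow> (center_mod G ^^ i) L \<subseteq> (center_mod G ^^ i) L'"
  by (induction i) (auto dest: centralizer_mod_mono)

lemma subset_center_mod_iter: "L \<lhd> G \<Longrightarrow> L \<subseteq> (center_mod G ^^ i) L"
  by (induction i) (use subset_center_mod[OF normal_center_mod_iter] in auto)

section \<open>Products and verbal subgroups\<close>

lemma rcoset_eq:
  assumes "N \<subseteq> carrier G" "x \<in> carrier G"
  shows "N #> x = {y \<in> carrier G. y \<otimes> inv x \<in> N}"
proof
  show "N #> x \<subseteq> {y \<in> carrier G. y \<otimes> inv x \<in> N}"
    using assms by (auto simp: r_coset_def m_assoc subset_iff)
  show "{y \<in> carrier G. y \<otimes> inv x \<in> N} \<subseteq> N #> x"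
  proof
    fix y assume "y \<in> {y \<in> carrier G. y \<otimes> inv x \<in> N}"
    moreover from this have "y = (y \<otimes> inv x) \<otimes> x" using assms by (simp add: m_assoc)
    ultimately show "y \<in> N #> x" unfolding r_coset_def by blast
  qed
qed

lemma subgroup_set_mult: "N \<lhd> G \<Longrightarrow> subgroup A G \<Longrightarrow> subgroup (N <#> A) G"
  by (rule second_isomorphism_grp.normal_set_mult_subgroup)
    (simp add: second_isomorphism_grp_def second_isomorphism_grp_axioms_def)

lemma subset_set_mult:
  assumes "N \<lhd> G" "subgroup A G"
  shows "N \<subseteq> N <#> A" "A \<subseteq> N <#> A"
proof -
  have S: "second_isomorphism_grp N G A"
    using assms by (simp add: second_isomorphism_grp_def second_isomorphism_grp_axioms_def)
  show "N \<subseteq> N <#> A" by (rule second_isomorphism_grp.H_contained_in_set_mult[OF S])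
  show "A \<subseteq> N <#> A" by (rule second_isomorphism_grp.S_contained_in_set_mult[OF S])
qed

lemma set_mult_le: "subgroup K G \<Longrightarrow> A \<subseteq> K \<Longrightarrow> B \<subseteq> K \<Longrightarrow> A <#> B \<subseteq> K"
  unfolding set_mult_def using subgroup.m_closed by fastforce

lemma pow_two: "x \<in> carrier G \<Longrightarrow> x [^] (2::nat) = x \<otimes> x"
  by (simp add: numeral_2_eq_2)

lemma pow_double: "x \<in> carrier G \<Longrightarrow> x [^] (2 ^ Suc r :: nat) = x [^] (2 ^ r :: nat) \<otimes> x [^] (2 ^ r :: nat)"
  by (simp add: nat_pow_mult mult_2)

text \<open>If x = n a, then x and a have the same coset modulo \<open>N\<close>, hence so do their
  powers. This reduces statements on powers in N gamma_k to gamma_k.\<close>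

lemma pow_mem_of_set_mult:
  assumes N: "N \<lhd> G" and K: "subgroup K G" "N \<subseteq> K" and A: "A \<subseteq> carrier G"
    and x: "x \<in> N <#> A" and pow: "\<And>a. a \<in> A \<Longrightarrow> a [^] (m::nat) \<in> K"
  shows "x [^] m \<in> K"
proof -
  interpret N: normal N G by fact
  obtain n a where n: "n \<in> N" and a: "a \<in> A" and x': "x = n \<otimes> a"
    using x unfolding set_mult_def by blast
  have c: "a \<in> carrier G" "n \<in> carrier G" using a A n by (auto simp: N.mem_carrier)
  have "N #> x = N #> a"
    using N.rcos_const[OF is_group n] c coset_mult_assoc[OF N.subset, of n a] by (simp add: x')
  then have "N #> x [^] m = N #> a [^] m"
    using N.FactGroup_pow[of x m] N.FactGroup_pow[of a m] c by (simp add: x')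
  then have "x [^] m \<in> N #> a [^] m"
    using rcos_self[of "x [^] m" N] N.subgroup_axioms c by (simp add: x')
  then obtain n' where "n' \<in> N" "x [^] m = n' \<otimes> a [^] m" unfolding r_coset_def by blast
  then show ?thesis using subgroup.m_closed[OF K(1), of n'] K(2) pow[OF a] by auto
qed

lemma conj_nat_pow:
  assumes "g \<in> carrier G" "x \<in> carrier G"
  shows "g \<otimes> x [^] (k::nat) \<otimes> inv g = (g \<otimes> x \<otimes> inv g) [^] k"
proof (induction k)
  case (Suc k)
  have "g \<otimes> x [^] Suc k \<otimes> inv g = (g \<otimes> x [^] k \<otimes> inv g) \<otimes> (g \<otimes> x \<otimes> inv g)"
    using assms by (simp add: group_word_simps)
  then show ?case using Suc.IH by simp
qed (use assms in simp)

lemma normal_power_subgroup: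
  assumes "N \<lhd> G"
  shows "power_subgroup G N k \<lhd> G"
proof -
  interpret N: normal N G by fact
  show ?thesis unfolding power_subgroup_def
  proof (rule normal_generateI)
    fix h g assume "h \<in> (\<lambda>x. x [^] k) ` N" and g: "g \<in> carrier G"
    then obtain x where x: "x \<in> N" "h = x [^] k" by blast
    then show "g \<otimes> h \<otimes> inv g \<in> (\<lambda>x. x [^] k) ` N"
      using g normal_conj[OF assms x(1) g] by (auto simp: conj_nat_pow)
  qed (use N.subset in auto)
qed

lemma commutator_subgroup_le:
  assumes "subgroup K G" "\<And>a b. a \<in> A \<Longrightarrow> b \<in> B \<Longrightarrow> commutator a b \<in> K"
  shows "commutator_subgroup G A B \<subseteq> K"
  unfolding commutator_subgroup_def by (rule generate_subgroup_incl) (use assms in auto)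

lemma commutator_in_commutator_subgroup:
  "a \<in> A \<Longrightarrow> b \<in> B \<Longrightarrow> commutator a b \<in> commutator_subgroup G A B"
  unfolding commutator_subgroup_def by (rule generate.incl) auto

lemma normal_commutator_subgroup:
  assumes "N \<lhd> G"
  shows "commutator_subgroup G N (carrier G) \<lhd> G"
proof -
  interpret N: normal N G by fact
  show ?thesis unfolding commutator_subgroup_def
  proof (rule normal_generateI)
    show "(\<Union>a\<in>N. \<Union>b\<in>carrier G. {commutator a b}) \<subseteq> carrier G"
      by auto
  next
    fix h g assume "h \<in> (\<Union>a\<in>N. \<Union>b\<in>carrier G. {commutator a b})" and g: "g \<in> carrier G"
    then obtain a b where a: "a \<in> N" "b \<in> carrier G" "h = commutator a b" by blast
    have ac: "a \<in> carrier G" using a(1) by (rule N.mem_carrier)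
    have "g \<otimes> h \<otimes> inv g = commutator (g \<otimes> a \<otimes> inv g) (g \<otimes> b \<otimes> inv g)"
      unfolding a(3) using ac a(2) g by (simp add: group_word_simps)
    moreover have "g \<otimes> a \<otimes> inv g \<in> N" "g \<otimes> b \<otimes> inv g \<in> carrier G"
      using a g normal_conj[OF assms a(1) g] by simp_all
    ultimately show "g \<otimes> h \<otimes> inv g \<in> (\<Union>a\<in>N. \<Union>b\<in>carrier G. {commutator a b})"
      by (intro UN_I[of "g \<otimes> a \<otimes> inv g"] UN_I[of "g \<otimes> b \<otimes> inv g"]) simp_all
  qed
qed

lemma commutator_subgroup_subset:
  assumes "N \<lhd> G"
  shows "commutator_subgroup G N (carrier G) \<subseteq> N"
  using assms by (intro commutator_subgroup_le normal_imp_subgroup normal_commutator)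

section \<open>The lower central series and iterated centres\<close>

lemma carrier_normal: "carrier G \<lhd> G"
  by (rule normal_invI[OF subgroup_self]) auto

lemma normal_lower_central: "lower_central G k \<lhd> G"
proof (induction k)
  case 0
  then show ?case by (simp add: carrier_normal)
next
  case (Suc k)
  then show ?case by (cases k) (auto simp: carrier_normal intro: normal_commutator_subgroup)
qed

lemma lower_central_Suc_subset: "lower_central G (Suc k) \<subseteq> lower_central G k"
  by (cases k) (simp_all add: commutator_subgroup_subset[OF normal_lower_central])

text \<open>The dummy value at index 0 equals the value at 1, so centrality is trivial there and the
  series is central over all natural indices.\<close>

lemma lower_central_subset_center_mod:
  "lower_central G k \<subseteq> center_mod G (lower_central G (Suc k))"
proof (cases k)
  case 0
  then show ?thesis by (auto simp: centralizer_mod_def)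
next
  case (Suc j)
  then show ?thesis
    using subgroup.subset[OF normal_imp_subgroup[OF normal_lower_central[of k]]]
    by (auto simp: centralizer_mod_def intro!: commutator_in_commutator_subgroup)
qed

text \<open>Each commutation with the whole group uses up one application of
  \<open>center_mod\<close>; after \<open>i\<close> of them \<open>L\<close> is reached.\<close>

lemma lower_central_le_of_center_mod_iter:
  assumes "L \<lhd> G" "lower_central G (Suc k) \<subseteq> (center_mod G ^^ i) L"
  shows "lower_central G (Suc (k + i)) \<subseteq> L"
  using assms(2)
proof (induction i arbitrary: k)
  case (Suc i)
  have "lower_central G (Suc (Suc k)) \<subseteq> (center_mod G ^^ i) L"
    unfolding lower_central.simps
    by (rule commutator_subgroup_le[OF normal_imp_subgroup[OF normal_center_mod_iter[OF assms(1)]]])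
      (use Suc.prems in \<open>auto simp: centralizer_mod_def\<close>)
  from Suc.IH[OF this] show ?case by simp
qed simp

text \<open>Links the definition of \<open>nth_center\<close>, phrased through cosets, to
  commutators: L x and L y commute iff x y lies in L y x, that is, iff [x, y] lies in
  \<open>L\<close>.\<close>

lemma center_mod_eq:
  assumes "L \<lhd> G"
  shows "{x \<in> carrier G. L #> x \<in> group_center (G Mod L)} = center_mod G L"
proof -
  interpret L: normal L G by fact
  have *: "L #> (x \<otimes> y) = L #> (y \<otimes> x) \<longleftrightarrow> commutator x y \<in> L"
    if "x \<in> carrier G" "y \<in> carrier G" for x y
  proof -
    have "L #> (x \<otimes> y) = L #> (y \<otimes> x) \<longleftrightarrow> x \<otimes> y \<in> L #> (y \<otimes> x)"
      using that by (metis L.subgroup_axioms m_closed rcos_self repr_independence)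
    also have "\<dots> \<longleftrightarrow> (x \<otimes> y) \<otimes> inv (y \<otimes> x) \<in> L"
      using that L.rcos_module[OF is_group] by simp
    finally show ?thesis using that by (simp add: group_word_simps)
  qed
  show ?thesis unfolding centralizer_mod_def
    by (rule Collect_cong)
      (auto simp add: group_center_def carrier_FactGroup L.rcos_sum simp flip: *)
qed

lemma nth_center_eq: "nth_center G n = (center_mod G ^^ n) {\<one>}"
proof (induction n)
  case (Suc n)
  have "nth_center G n \<lhd> G" unfolding Suc.IH by (rule normal_center_mod_iter[OF one_is_normal])
  from center_mod_eq[OF this] show ?case using Suc.IH by simp
qed simp

lemma normal_nth_center: "nth_center G n \<lhd> G"
  unfolding nth_center_eq by (rule normal_center_mod_iter[OF one_is_normal])

lemma nth_center_subset_center_mod_iter: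
  assumes "L \<lhd> G"
  shows "nth_center G n \<subseteq> (center_mod G ^^ n) L"
  unfolding nth_center_eq
  by (rule center_mod_iter_mono) (use normal_imp_subgroup[OF assms] subgroup.one_closed in auto)

end

section \<open>Powers along a central series\<close>

text \<open>\<open>mixed_powers G \<Gamma> r k\<close> is the product of the groups \<open>\<Gamma>\<^sub>k\<^sub>+\<^sub>i\<close> raised to \<open>2\<^sup>r\<^sup>-\<^sup>i\<close>, \<open>i \<le> r\<close>.\<close>

primrec mixed_powers :: "('a, 'b) monoid_scheme \<Rightarrow> (nat \<Rightarrow> 'a set) \<Rightarrow> nat \<Rightarrow> nat \<Rightarrow> 'a set" where
  "mixed_powers G \<Gamma> 0 k = \<Gamma> k"
| "mixed_powers G \<Gamma> (Suc r) k =
     generate G ((\<lambda>x. x [^]\<^bsub>G\<^esub> (2 ^ Suc r :: nat)) ` \<Gamma> k \<union> mixed_powers G \<Gamma> r (Suc k))"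

text \<open>The series is left abstract because the instance used is N gamma_k with \<open>N\<close>
  open and normal, not gamma_k itself.\<close>

locale central_series = group G for G (structure) +
  fixes \<Gamma> :: "nat \<Rightarrow> 'a set"
  assumes normal_series: "\<Gamma> k \<lhd> G"
    and decreasing: "\<Gamma> (Suc k) \<subseteq> \<Gamma> k"
    and central: "\<Gamma> k \<subseteq> center_mod G (\<Gamma> (Suc k))"
begin

abbreviation "S \<equiv> mixed_powers G \<Gamma>"

lemma series_carrier: "x \<in> \<Gamma> k \<Longrightarrow> x \<in> carrier G"
  using normal_imp_subgroup[OF normal_series] subgroup.mem_carrier by fast

lemma normal_mixed_powers: "S r k \<lhd> G"
proof (induction r arbitrary: k)
  case (Suc r)
  show ?case unfolding mixed_powers.simps
  proof (rule normal_generateI)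
    show "(\<lambda>x. x [^] (2 ^ Suc r :: nat)) ` \<Gamma> k \<union> S r (Suc k) \<subseteq> carrier G"
      using series_carrier subgroup.subset[OF normal_imp_subgroup[OF Suc.IH]] by auto
  next
    fix h g
    assume h: "h \<in> (\<lambda>x. x [^] (2 ^ Suc r :: nat)) ` \<Gamma> k \<union> S r (Suc k)" and g: "g \<in> carrier G"
    show "g \<otimes> h \<otimes> inv g \<in> (\<lambda>x. x [^] (2 ^ Suc r :: nat)) ` \<Gamma> k \<union> S r (Suc k)"
    proof (cases "h \<in> S r (Suc k)")
      case True
      then show ?thesis using normal_conj[OF Suc.IH _ g] by blast
    next
      case False
      with h obtain x where "x \<in> \<Gamma> k" "h = x [^] (2 ^ Suc r :: nat)" by blast
      then show ?thesis
        using g normal_conj[OF normal_series _ g, of x k] series_carrier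
        by (auto simp: conj_nat_pow simp del: power_Suc)
    qed
  qed
qed (simp add: normal_series)

lemma subgroup_mixed_powers: "subgroup (S r k) G"
  by (rule normal_imp_subgroup[OF normal_mixed_powers])

lemma mixed_powers_carrier: "S r k \<subseteq> carrier G"
  by (rule subgroup.subset[OF subgroup_mixed_powers])

lemma mixed_powers_Suc_subset: "S r (Suc k) \<subseteq> S (Suc r) k"
  by (auto intro: generate.incl)

lemma pow_in_mixed_powers: "x \<in> \<Gamma> k \<Longrightarrow> x [^] (2 ^ r :: nat) \<in> S r k"
  using series_carrier by (cases r) (auto intro: generate.incl)

text \<open>This is the last factor, i = r, whose exponent is 1.\<close>

lemma series_subset_mixed_powers: "\<Gamma> (k + r) \<subseteq> S r k"
proof (induction r arbitrary: k)
  case (Suc r)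
  have "\<Gamma> (k + Suc r) \<subseteq> S r (Suc k)" using Suc.IH[of "Suc k"] by simp
  then show ?case using mixed_powers_Suc_subset[of r k] by (rule order_trans)
qed simp

lemma mixed_powers_le:
  assumes "subgroup K G"
    and "\<And>i x. i \<le> r \<Longrightarrow> x \<in> \<Gamma> (k + i) \<Longrightarrow> x [^] (2 ^ (r - i) :: nat) \<in> K"
  shows "S r k \<subseteq> K"
  using assms(2)
proof (induction r arbitrary: k)
  case 0
  then show ?case using series_carrier by fastforce
next
  case (Suc r)
  have "S r (Suc k) \<subseteq> K"
    \<comment> \<open>Factor i of \<open>S r (Suc k)\<close> is factor i + 1 of
      \<open>S (Suc r) k\<close>: the same term of the series with the same exponent.\<close>
    using Suc.prems[of "Suc _"] by (intro Suc.IH) auto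
  then show ?case unfolding mixed_powers.simps
    using Suc.prems[of 0] by (intro generate_subgroup_incl[OF _ assms(1)]) auto
qed

text \<open>The halves feed each other. For a generator y^2 with y in \<open>S r k\<close>, the
  first half at r puts c = [y, g] into \<open>S r (Suc k)\<close>, and the second half at r then
  puts [y, c] c^2 into \<open>S (Suc r) (Suc k)\<close>. This is the first half at r + 1, from which
  the second half at r + 1 follows. The shift in k is why k is quantified inside.\<close>

lemma mixed_powers_central_aux:
  "(\<forall>k. S r k \<subseteq> center_mod G (S r (Suc k))) \<and> (\<forall>k. S r k \<subseteq> exp2_center_mod G (S (Suc r) k))"
proof (induction r)
  case 0
  have "\<Gamma> k \<subseteq> exp2_center_mod G (S (Suc 0) k)" for k
  proof
    fix x assume x: "x \<in> \<Gamma> k"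
    then have "x \<in> center_mod G (S (Suc 0) k)"
      using central[of k] centralizer_mod_mono[OF mixed_powers_Suc_subset[of 0 k]] by auto
    moreover have "x [^] (2 ^ Suc 0 :: nat) = x \<otimes> x"
      using pow_double[OF series_carrier[OF x], of 0] series_carrier[OF x] by simp
    then have "x \<otimes> x \<in> S (Suc 0) k"
      using pow_in_mixed_powers[OF x, of "Suc 0"] by (simp del: mixed_powers.simps)
    ultimately show "x \<in> exp2_center_mod G (S (Suc 0) k)" by (simp add: exp2_center_mod_def)
  qed
  then show ?case using central by simp
next
  case (Suc r)
  then have A: "S r k \<subseteq> center_mod G (S r (Suc k))" and B: "S r k \<subseteq> exp2_center_mod G (S (Suc r) k)" for k
    by auto
  have A': "S (Suc r) k \<subseteq> center_mod G (S (Suc r) (Suc k))" (is "_ \<subseteq> ?C") for k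
  proof -
    have "x [^] (2 ^ Suc r :: nat) \<in> ?C" if x: "x \<in> \<Gamma> k" for x
    proof -
      define y where "y = x [^] (2 ^ r :: nat)"
      have yc: "y \<in> carrier G" using series_carrier[OF x] by (simp add: y_def)
      have "commutator (y \<otimes> y) g \<in> S (Suc r) (Suc k)" if g: "g \<in> carrier G" for g
      proof (rule square_commutator_mem[OF normal_mixed_powers yc g])
        have "commutator y g \<in> S r (Suc k)"
          using A[of k] pow_in_mixed_powers[OF x] g by (auto simp: y_def centralizer_mod_def)
        then show "commutator y g \<in> exp2_center_mod G (S (Suc r) (Suc k))" using B by blast
      qed
      then show ?thesis
        using yc unfolding pow_double[OF series_carrier[OF x]] y_def[symmetric]
        by (simp add: centralizer_mod_def del: mixed_powers.simps)
    qed
    moreover have "S r (Suc k) \<subseteq> ?C"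
      using A[of "Suc k"] centralizer_mod_mono[OF mixed_powers_Suc_subset] by blast
    ultimately show ?thesis
      unfolding mixed_powers.simps(2)[of _ _ _ k]
      by (intro generate_subgroup_incl subgroup_centralizer_mod normal_mixed_powers) auto
  qed
  have B': "S (Suc r) k \<subseteq> exp2_center_mod G (S (Suc (Suc r)) k)" (is "_ \<subseteq> ?E") for k
  proof -
    \<comment> \<open>Centrality comes from \<open>A'\<close>, as \<open>S (Suc r) (Suc k)\<close>
      lies in \<open>S (Suc (Suc r)) k\<close>. What remains is to square the generators, which is
      enough because \<open>?E\<close> is a subgroup.\<close>
    have C: "S (Suc r) k \<subseteq> center_mod G (S (Suc (Suc r)) k)"
      using A'[of k] centralizer_mod_mono[OF mixed_powers_Suc_subset] by blast
    have "x [^] (2 ^ Suc r :: nat) \<in> ?E" if x: "x \<in> \<Gamma> k" for x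
      using C pow_in_mixed_powers[OF x, of "Suc r"] pow_in_mixed_powers[OF x, of "Suc (Suc r)"]
        pow_double[OF series_carrier[OF x], of "Suc r"]
      by (auto simp: exp2_center_mod_def simp del: mixed_powers.simps power_Suc)
    moreover have "x \<in> ?E" if x: "x \<in> S r (Suc k)" for x
    proof -
      have "x \<otimes> x \<in> S (Suc r) (Suc k)" using B x by (auto simp: exp2_center_mod_def)
      then show ?thesis
        using C x mixed_powers_Suc_subset[of r k] mixed_powers_Suc_subset[of "Suc r" k]
        by (auto simp: exp2_center_mod_def simp del: mixed_powers.simps)
    qed
    ultimately show ?thesis
      unfolding mixed_powers.simps(2)[of _ _ r k]
      by (intro generate_subgroup_incl normal_imp_subgroup normal_exp2_center_mod normal_mixed_powers)
        auto
  qed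
  from A' B' show ?case by blast
qed

lemma mixed_powers_central: "S r k \<subseteq> center_mod G (S r (Suc k))"
  and mixed_powers_exp2_central: "S r k \<subseteq> exp2_center_mod G (S (Suc r) k)"
  using mixed_powers_central_aux by auto

lemma mixed_powers_center_mod_iter: "S r k \<subseteq> (center_mod G ^^ i) (S r (k + i))"
proof (induction i arbitrary: k)
  case (Suc i)
  have "S r k \<subseteq> center_mod G (S r (Suc k))" by (rule mixed_powers_central)
  also have "\<dots> \<subseteq> center_mod G ((center_mod G ^^ i) (S r (Suc k + i)))"
    by (rule centralizer_mod_mono[OF Suc.IH])
  finally show ?case by simp
qed simp

text \<open>The squaring identity with the roles exchanged: the square is now an arbitrary element
  g^2. For y in \<open>S r k\<close>, c = [g, y] lies in \<open>S r (Suc k)\<close>, and passing to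
  [g, c] c^2 raises r by one. Trading the shift of k for another raise of r gives the gain of
  two.\<close>

lemma square_centralizes_mixed_powers:
  assumes "g \<in> carrier G"
  shows "g \<otimes> g \<in> centralizer_mod G (S r k) (S (Suc (Suc r)) k)"
proof -
  have "commutator (g \<otimes> g) y \<in> S (Suc (Suc r)) k" if y: "y \<in> S r k" for y
  proof -
    have yc: "y \<in> carrier G" using y mixed_powers_carrier by blast
    have "commutator y g \<in> S r (Suc k)"
      using mixed_powers_central[of r k] y assms by (auto simp: centralizer_mod_def)
    then have "inv (commutator y g) \<in> S r (Suc k)"
      by (rule subgroup.m_inv_closed[OF subgroup_mixed_powers])
    then have "commutator g y \<in> exp2_center_mod G (S (Suc r) (Suc k))"
      using mixed_powers_exp2_central yc assms by (auto simp: inv_commutator)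
    from square_commutator_mem[OF normal_mixed_powers assms yc this] show ?thesis
      using mixed_powers_Suc_subset by blast
  qed
  then show ?thesis using assms by (simp add: centralizer_mod_def del: mixed_powers.simps)
qed

text \<open>\<open>[a, b] = a\<^sup>2 (a\<^sup>-\<^sup>1 b)\<^sup>2 b\<^sup>-\<^sup>2\<close> is a product of squares.\<close>

lemma commutator_centralizes_mixed_powers:
  assumes "a \<in> carrier G" "b \<in> carrier G"
  shows "commutator a b \<in> centralizer_mod G (S r k) (S (Suc (Suc r)) k)" (is "_ \<in> ?C")
proof -
  have C: "subgroup ?C G"
    by (rule subgroup_centralizer_mod[OF normal_mixed_powers mixed_powers_carrier])
  have "(a \<otimes> a) \<otimes> ((inv a \<otimes> b) \<otimes> (inv a \<otimes> b)) \<otimes> (inv b \<otimes> inv b) \<in> ?C"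
    using assms by (intro subgroup.m_closed[OF C] square_centralizes_mixed_powers) auto
  then show ?thesis using assms by (simp add: group_word_simps)
qed

end

section \<open>Finite p-groups\<close>

context group
begin

text \<open>The class equation: every conjugacy class has p-power size, and with trivial centre {1}
  is the only one of size 1, so the order would be 1 modulo p.\<close>

lemma p_group_center_nontrivial:
  fixes p :: nat
  assumes p: "Factorial_Ring.prime p" and order: "order G = p ^ k" "k > 0"
  shows "\<exists>z\<in>group_center G. z \<noteq> \<one>"
proof (rule ccontr)
  assume contra: "\<not> (\<exists>z\<in>group_center G. z \<noteq> \<one>)"
  define \<phi> where "\<phi> = (\<lambda>g. \<lambda>h\<in>carrier G. g \<otimes> h \<otimes> inv g)"
  interpret A: group_action G "carrier G" \<phi>
    unfolding \<phi>_def by (rule action_by_conjugation)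
  have "order G > 0" using order p by (simp add: prime_gt_0_nat)
  then have fin: "finite (carrier G)" by (simp add: order_gt_0_iff_finite)
  let ?O = "orbits G (carrier G) \<phi>" and ?o = "orbit G \<phi> \<one>"
  have finO: "finite ?O" using fin by (simp add: orbits_def)
  have one_orbit: "?o = {\<one>}" using one_closed by (force simp: orbit_def \<phi>_def)
  have "p dvd card b" if "b \<in> ?O - {?o}" for b
  proof -
    from that obtain x where x: "x \<in> carrier G" and b: "b = orbit G \<phi> x"
      by (auto simp: orbits_def)
    have "card b dvd p ^ k"
      using A.orbit_stabilizer_theorem[OF x] order(1) b by (metis dvd_triv_left)
    then obtain i where i: "card b = p ^ i" using p by (auto simp: divides_primepow_nat)
    have xb: "x \<in> b" unfolding b by (rule A.orbit_refl[OF x])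
    have "i \<noteq> 0"
    proof
      assume "i = 0"
      with i obtain y where "b = {y}" by (auto simp: card_1_singleton_iff)
      with xb have bx: "b = {x}" by simp
      have "x \<otimes> g = g \<otimes> x" if g: "g \<in> carrier G" for g
      proof -
        have "\<phi> g x \<in> b" unfolding b orbit_def using g by blast
        then have "g \<otimes> x \<otimes> inv g = x" using bx x g by (simp add: \<phi>_def)
        then show ?thesis using x g by (metis inv_solve_right m_closed)
      qed
      then have "x = \<one>" using contra x by (auto simp: group_center_def)
      then show False using that b by simp
    qed
    then show ?thesis using i by simp
  qed
  then have "p dvd (\<Sum>b\<in>?O - {?o}. card b)" by (rule dvd_sum)
  moreover have "order G = 1 + (\<Sum>b\<in>?O - {?o}. card b)"
  proof -
    have "order G = (\<Sum>b\<in>?O. card b)"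
      using A.disjoint_sum[OF fin, of "\<lambda>_. 1 :: nat"] by (simp add: order_def)
    also have "\<dots> = card ?o + (\<Sum>b\<in>?O - {?o}. card b)"
      by (rule sum.remove[OF finO]) (auto simp: orbits_def)
    finally show ?thesis by (simp add: one_orbit)
  qed
  moreover have "p dvd order G" using order by simp
  ultimately have "p dvd 1" by (metis dvd_add_left_iff)
  then show False using p by (simp add: prime_nat_iff)
qed

text \<open>Take a nontrivial central x and the last nontrivial member of the sequence x, x^p,
  x^(p^2), ...\<close>

lemma central_element_of_order_p:
  fixes p :: nat
  assumes p: "Factorial_Ring.prime p" and order: "order G = p ^ k" "k > 0"
  obtains z where "z \<in> group_center G" "z \<noteq> \<one>" "z [^] p = \<one>"
proof -
  obtain x where x: "x \<in> group_center G" "x \<noteq> \<one>"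
    using p_group_center_nontrivial[OF assms] by blast
  then have xc: "x \<in> carrier G" by (simp add: group_center_def)
  have power_central: "x [^] (i::nat) \<in> group_center G" for i
  proof (induction i)
    case (Suc i)
    define a where "a = x [^] i"
    have a: "a \<in> carrier G" "\<And>w. w \<in> carrier G \<Longrightarrow> a \<otimes> w = w \<otimes> a"
      using Suc.IH by (auto simp: group_center_def a_def)
    have "a \<otimes> x \<otimes> w = w \<otimes> (a \<otimes> x)" if w: "w \<in> carrier G" for w
    proof -
      have "x \<otimes> w = w \<otimes> x" using x w by (simp add: group_center_def)
      then have "a \<otimes> x \<otimes> w = a \<otimes> w \<otimes> x" using a(1) xc w by (simp add: m_assoc)
      also have "\<dots> = w \<otimes> (a \<otimes> x)" using a(1) xc w by (simp add: a(2)[OF w] m_assoc)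
      finally show ?thesis .
    qed
    then show ?case using a(1) xc by (simp add: group_center_def a_def)
  qed (simp add: group_center_def)
  define j where "j = (LEAST i. x [^] (p ^ i) = \<one>)"
  have "x [^] (p ^ k) = \<one>" using pow_order_eq_1[OF xc] order by simp
  then have j: "x [^] (p ^ j) = \<one>" unfolding j_def by (rule LeastI)
  have "j \<noteq> 0"
  proof
    assume "j = 0"
    with j xc have "x = \<one>" by simp
    with x show False by simp
  qed
  then obtain i where i: "j = Suc i" by (cases j) auto
  have "x [^] (p ^ i) \<noteq> \<one>" using not_less_Least[of i "\<lambda>i. x [^] (p ^ i) = \<one>"] i by (simp add: j_def)
  moreover have "(x [^] (p ^ i)) [^] p = \<one>"
    using j xc by (simp add: i nat_pow_pow mult.commute)
  ultimately show ?thesis using power_central that by blast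
qed

text \<open>A prime divisor q of the order other than p would give, by Cauchy's theorem, a
  nontrivial element whose order divides both q and p^k.\<close>

lemma order_power_of_exponent_power:
  fixes p :: nat
  assumes p: "Factorial_Ring.prime p" and fin: "finite (carrier G)"
    and exp: "\<And>x. x \<in> carrier G \<Longrightarrow> x [^] (p ^ k) = \<one>"
  shows "\<exists>j. order G = p ^ j"
proof -
  have "order G \<noteq> 0" using fin order_gt_0_iff_finite by simp
  then obtain i m where m: "\<not> p dvd m" "order G = p ^ i * m"
    using multiplicity_decompose'[of "order G" p] p by (metis not_prime_unit)
  have "m = 1"
  proof (rule ccontr)
    assume "m \<noteq> 1"
    then obtain q where q: "Factorial_Ring.prime q" "q dvd m" using prime_factor_nat by blast
    then have "q dvd order G" using m(2) by simp
    \<comment> \<open>Sylow's theorem at exponent 1 is the existence part of Cauchy's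
      theorem.\<close>
    then obtain c where c: "order G = q ^ 1 * c" by auto
    then obtain K where K: "subgroup K G" "card K = q"
      using sylow_thm[OF q(1) is_group c fin] by auto
    have "card K > 1" using K q(1) prime_gt_1_nat by blast
    then have "K \<noteq> {\<one>}" by auto
    then obtain x where x: "x \<in> K" "x \<noteq> \<one>" using subgroup.one_closed[OF K(1)] by blast
    have xc: "x \<in> carrier G" using subgroup.mem_carrier[OF K(1) x(1)] .
    interpret K: group "G\<lparr>carrier := K\<rparr>" by (rule subgroup_imp_group[OF K(1)])
    have "x [^]\<^bsub>G\<lparr>carrier := K\<rparr>\<^esub> q = \<one>"
      using K.pow_order_eq_1[of x] x K(2) by (simp add: order_def)
    then have "x [^] q = \<one>" by (simp add: nat_pow_consistent[symmetric])
    then have "ord x dvd q" using pow_eq_id[OF xc] by simp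
    moreover have "ord x dvd p ^ k" using pow_eq_id[OF xc] exp[OF xc] by simp
    moreover have "coprime q (p ^ k)"
      using p q m(1) by (metis coprime_power_right_iff primes_coprime)
    ultimately have "ord x = 1" by (metis coprime_common_divisor_nat)
    then show False using ord_eq_1[OF xc] x(2) by simp
  qed
  then show ?thesis using m(2) by auto
qed

end

section \<open>Profinite groups\<close>

locale top_group = group G for G (structure) +
  fixes T :: "'a topology"
  assumes topological: "topological_group G T"
begin

lemma topspace: "topspace T = carrier G"
  using topological by (simp add: topological_group_def)

lemma open_carrier: "openin T U \<Longrightarrow> U \<subseteq> carrier G"
  using openin_subset topspace by blast

lemma continuous_mult:
  assumes "continuous_map X T f" "continuous_map X T g"
  shows "continuous_map X T (\<lambda>x. f x \<otimes> g x)"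
proof -
  have "continuous_map X (prod_topology T T) (\<lambda>x. (f x, g x))"
    using assms by (simp add: continuous_map_pairwise o_def)
  from continuous_map_compose[OF this, of T "\<lambda>(x, y). x \<otimes> y"] show ?thesis
    using topological by (simp add: topological_group_def o_def)
qed

lemma open_translate:
  assumes "openin T U" "a \<in> carrier G" "b \<in> carrier G"
  shows "openin T {x \<in> carrier G. a \<otimes> x \<otimes> b \<in> U}"
proof -
  have "continuous_map T T (\<lambda>x. a \<otimes> x \<otimes> b)"
    using assms topspace by (intro continuous_mult) auto
  from openin_continuous_map_preimage[OF this assms(1)] show ?thesis by (simp add: topspace)
qed

lemma open_rcoset:
  assumes "openin T N" "x \<in> carrier G"
  shows "openin T (N #> x)"
proof -
  have "{y \<in> carrier G. \<one> \<otimes> y \<otimes> inv x \<in> N} = N #> x"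
    using assms open_carrier by (subst rcoset_eq) auto
  then show ?thesis using open_translate[of N \<one> "inv x"] assms by simp
qed

lemma open_of_rcosets:
  assumes "openin T N" "subgroup N G" "S \<subseteq> carrier G" "\<And>x. x \<in> S \<Longrightarrow> N #> x \<subseteq> S"
  shows "openin T S"
proof (subst openin_subopen, intro ballI)
  fix x assume x: "x \<in> S"
  then show "\<exists>U. openin T U \<and> x \<in> U \<and> U \<subseteq> S"
    using assms open_rcoset rcos_self by (intro exI[of _ "N #> x"]) auto
qed

lemma open_supergroup:
  assumes "openin T N" "subgroup N G" "subgroup K G" "N \<subseteq> K"
  shows "openin T K"
  using assms
  by (intro open_of_rcosets[OF assms(1,2)])
    (auto simp: r_coset_def subgroup.subset subgroup.m_closed subset_iff dest: subgroup.subset)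

lemma open_subgroup_closed:
  assumes "openin T K" "subgroup K G"
  shows "closedin T K"
proof -
  have "openin T (carrier G - K)"
  proof (rule open_of_rcosets[OF assms])
    fix x assume x: "x \<in> carrier G - K"
    show "K #> x \<subseteq> carrier G - K"
    proof
      fix y assume "y \<in> K #> x"
      then obtain k where k: "k \<in> K" "y = k \<otimes> x" by (auto simp: r_coset_def)
      have kc: "k \<in> carrier G" using k assms(2) subgroup.mem_carrier by fast
      have "x = inv k \<otimes> y" using k kc x by (simp add: inv_mult_cancel)
      then have "y \<notin> K"
        using x k subgroup.m_closed[OF assms(2) subgroup.m_inv_closed[OF assms(2)]] by force
      then show "y \<in> carrier G - K" using k kc x by simp
    qed
  qed auto
  then show ?thesis using assms(2) by (simp add: closedin_def topspace subgroup.subset)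
qed

section \<open>Open subgroups of compact groups: finite index and normal cores\<close>

lemma finite_rcosets:
  assumes "compact_space T" "openin T K" "subgroup K G"
  shows "finite (rcosets K)"
proof -
  have op: "\<forall>U\<in>rcosets K. openin T U"
    using open_rcoset[OF assms(2)] by (auto simp: RCOSETS_def)
  have cov: "\<Union>(rcosets K) = topspace T"
    using rcosets_part_G[OF assms(3)] topspace by simp
  obtain F where F: "finite F" "F \<subseteq> rcosets K" "\<Union>F = topspace T"
    using assms(1)[unfolded compact_space, rule_format, OF conjI[OF op cov]] by auto
  have "C \<in> F" if C: "C \<in> rcosets K" for C
  proof -
    obtain x where x: "x \<in> C"
      using C subgroup.rcosets_non_empty[OF assms(3) C] by blast
    then obtain D where D: "D \<in> F" "x \<in> D" using F(3) cov C by blast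
    then have "C = D"
      using rcos_disjoint[OF assms(3)] C F(2) x
      by (metis (mono_tags, lifting) disjnt_iff pairwiseD subsetD)
    then show ?thesis using D by simp
  qed
  then have "rcosets K \<subseteq> F" by (rule subsetI)
  then show ?thesis using F(1) by (rule finite_subset)
qed

text \<open>The core is an intersection of conjugates x^-1 K x over all x, but each depends only on
  the coset K x, being its stabilizer under right translation. There are finitely many cosets, so
  the intersection is open.\<close>

lemma open_normal_core:
  assumes "compact_space T" "openin T K" "subgroup K G"
  shows "\<exists>N. N \<lhd> G \<and> openin T N \<and> N \<subseteq> K"
proof -
  define N where "N = {y \<in> carrier G. \<forall>x\<in>carrier G. x \<otimes> y \<otimes> inv x \<in> K}"
  define stab where "stab C = {y \<in> carrier G. C #> y = C}" for C
  have stab: "stab (K #> x) = {y \<in> carrier G. x \<otimes> y \<otimes> inv x \<in> K}" if x: "x \<in> carrier G" for x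
  proof -
    have "K #> x #> y = K #> x \<longleftrightarrow> x \<otimes> y \<otimes> inv x \<in> K" if y: "y \<in> carrier G" for y
    proof -
      have "K #> x #> y = K #> x \<longleftrightarrow> K #> (x \<otimes> y) = K #> x"
        using x y assms(3) by (simp add: coset_mult_assoc subgroup.subset)
      also have "\<dots> \<longleftrightarrow> x \<otimes> y \<in> K #> x"
        using x y assms(3) by (metis m_closed rcos_self repr_independence)
      finally show ?thesis using x y assms(3) by (simp add: rcoset_eq subgroup.subset)
    qed
    then show ?thesis by (auto simp: stab_def)
  qed
  have "N = (\<Inter>C\<in>rcosets K. stab C)"
    using stab one_closed by (auto simp: N_def RCOSETS_def)
  moreover have "openin T (stab C)" if "C \<in> rcosets K" for C
    using that stab open_translate[OF assms(2)] by (auto simp: RCOSETS_def)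
  moreover have "rcosets K \<noteq> {}"
    using subgroup.subgroup_in_rcosets[OF assms(3) is_group] by blast
  ultimately have "openin T N"
    using finite_rcosets[OF assms] by (auto intro!: openin_INT2)
  moreover have "N \<lhd> G"
  proof (rule normal_invI)
    show "subgroup N G"
    proof (rule subgroupI)
      show "N \<subseteq> carrier G" by (auto simp: N_def)
      have "\<one> \<in> N" using assms(3) by (auto simp: N_def subgroup.one_closed)
      then show "N \<noteq> {}" by blast
    next
      fix y assume y: "y \<in> N"
      then have yc: "y \<in> carrier G" by (simp add: N_def)
      have "x \<otimes> inv y \<otimes> inv x \<in> K" if x: "x \<in> carrier G" for x
      proof -
        have "inv (x \<otimes> y \<otimes> inv x) \<in> K"
          using y x by (intro subgroup.m_inv_closed[OF assms(3)]) (simp add: N_def)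
        then show ?thesis using x yc by (simp add: group_word_simps)
      qed
      then show "inv y \<in> N" using yc by (simp add: N_def)
    next
      fix y z assume y: "y \<in> N" and z: "z \<in> N"
      then have c: "y \<in> carrier G" "z \<in> carrier G" by (simp_all add: N_def)
      have "x \<otimes> (y \<otimes> z) \<otimes> inv x \<in> K" if x: "x \<in> carrier G" for x
      proof -
        have "(x \<otimes> y \<otimes> inv x) \<otimes> (x \<otimes> z \<otimes> inv x) \<in> K"
          using y z x by (intro subgroup.m_closed[OF assms(3), of "x \<otimes> y \<otimes> inv x"]) (simp_all add: N_def)
        then show ?thesis using x c by (simp add: group_word_simps)
      qed
      then show "y \<otimes> z \<in> N" using c by (simp add: N_def)
    qed
  next
    fix g y assume g: "g \<in> carrier G" and y: "y \<in> N"
    then have yc: "y \<in> carrier G" by (simp add: N_def)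
    have "x \<otimes> (g \<otimes> y \<otimes> inv g) \<otimes> inv x \<in> K" if x: "x \<in> carrier G" for x
    proof -
      have "(x \<otimes> g) \<otimes> y \<otimes> inv (x \<otimes> g) \<in> K" using y x g by (simp add: N_def)
      then show ?thesis using x g yc by (simp add: group_word_simps)
    qed
    then show "g \<otimes> y \<otimes> inv g \<in> N" using yc g by (simp add: N_def)
  qed
  moreover have "N \<subseteq> K"
  proof
    fix y assume "y \<in> N"
    then have "y \<in> carrier G" "\<one> \<otimes> y \<otimes> inv \<one> \<in> K" unfolding N_def by blast+
    then show "y \<in> K" by simp
  qed
  ultimately show ?thesis by blast
qed

end

locale profinite = top_group +
  assumes profinite: "profinite_group G T"
begin

lemma compact: "compact_space T" and Hausdorff: "Hausdorff_space T"
  using profinite by (simp_all add: profinite_group_def)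

lemma open_normal_basis:
  assumes "openin T U" "\<one> \<in> U"
  obtains N where "N \<lhd> G" "openin T N" "N \<subseteq> U"
proof -
  obtain K where "subgroup K G" "openin T K" "K \<subseteq> U"
    using profinite assms unfolding profinite_group_def by blast
  then show ?thesis using open_normal_core[OF compact] that by (meson order_trans)
qed

text \<open>The cosets N x form a neighbourhood basis at x, and N x meets A iff x lies in N A.
  Membership in a closure thereby becomes one algebraic condition for each open normal
  \<open>N\<close>.\<close>

lemma mem_closure_iff:
  assumes "A \<subseteq> carrier G"
  shows "x \<in> T closure_of A \<longleftrightarrow> x \<in> carrier G \<and> (\<forall>N. N \<lhd> G \<and> openin T N \<longrightarrow> x \<in> N <#> A)"
    (is "?l \<longleftrightarrow> ?r")
proof
  assume l: ?l
  then have x: "x \<in> carrier G" using in_closure_of topspace by fastforce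
  have "x \<in> N <#> A" if N: "N \<lhd> G" "openin T N" for N
  proof -
    interpret N: normal N G by fact
    have "openin T (N #> x)" "x \<in> N #> x"
      using open_rcoset[OF N(2) x] rcos_self[OF x N.subgroup_axioms] by auto
    then obtain a where a: "a \<in> A" "a \<in> N #> x" using l in_closure_of by metis
    then obtain n where n: "n \<in> N" "a = n \<otimes> x" by (auto simp: r_coset_def)
    then have "x = inv n \<otimes> a" using x by (simp add: inv_mult_cancel)
    then show ?thesis using n a unfolding set_mult_def by blast
  qed
  with x show ?r by blast
next
  assume r: ?r
  show ?l unfolding in_closure_of
  proof (intro conjI allI impI)
    show "x \<in> topspace T" using r topspace by simp
  next
    fix U assume U: "x \<in> U \<and> openin T U"
    have x: "x \<in> carrier G" using r by blast
    have "openin T {y \<in> carrier G. \<one> \<otimes> y \<otimes> x \<in> U}" using open_translate U x by blast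
    moreover have "\<one> \<in> {y \<in> carrier G. \<one> \<otimes> y \<otimes> x \<in> U}" using U x by simp
    ultimately obtain N where N: "N \<lhd> G" "openin T N" "N \<subseteq> {y \<in> carrier G. \<one> \<otimes> y \<otimes> x \<in> U}"
      by (rule open_normal_basis)
    interpret N: normal N G by fact
    have "x \<in> N <#> A" using r N by blast
    then obtain n a where n: "n \<in> N" "a \<in> A" "x = n \<otimes> a" unfolding set_mult_def by blast
    have "inv n \<otimes> x \<in> U" using N(3) N.m_inv_closed[OF n(1)] by auto
    moreover have "inv n \<otimes> x = a"
      using n assms N.mem_carrier[OF n(1)] by (simp add: inv_mult_cancel subset_iff)
    ultimately show "\<exists>y. y \<in> A \<and> y \<in> U" using n by blast
  qed
qed

lemma closure_eq_Inter:
  assumes "A \<subseteq> carrier G"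
  shows "T closure_of A = \<Inter>{N <#> A |N. N \<lhd> G \<and> openin T N}"
proof -
  have "carrier G <#> A \<subseteq> carrier G" using assms by (intro set_mult_closed) auto
  moreover have "openin T (carrier G)" using openin_topspace[of T] topspace by simp
  ultimately show ?thesis
    using mem_closure_iff[OF assms] carrier_normal by auto
qed

lemma normal_closure:
  assumes "A \<lhd> G"
  shows "T closure_of A \<lhd> G"
proof -
  have A: "subgroup A G" by (rule normal_imp_subgroup[OF assms])
  let ?F = "{N <#> A |N. N \<lhd> G \<and> openin T N}"
  have "openin T (carrier G)" using openin_topspace[of T] topspace by simp
  then have ne: "?F \<noteq> {}" using carrier_normal by blast
  have n: "B \<lhd> G" if B: "B \<in> ?F" for B
  proof -
    obtain N where "B = N <#> A" "N \<lhd> G" using B by blast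
    then show ?thesis using normal_subgroup_set_mult_closed[OF _ assms] by simp
  qed
  have sub: "subgroup (\<Inter>?F) G"
    using ne by (intro subgroups_Inter normal_imp_subgroup n)
  have "\<Inter>?F \<lhd> G"
  proof (rule normal_invI[OF sub], rule InterI)
    fix g x B assume "g \<in> carrier G" "x \<in> \<Inter>?F" "B \<in> ?F"
    then show "g \<otimes> x \<otimes> inv g \<in> B" using normal_conj[OF n] by (meson InterD)
  qed
  then show ?thesis using closure_eq_Inter[OF subgroup.subset[OF A]] by simp
qed

text \<open>The product is the image of the compact set A x B under multiplication. It is needed
  because \<open>lower_p_series\<close> multiplies two closures without closing the result.\<close>

lemma closed_set_mult:
  assumes "closedin T A" "closedin T B"
  shows "closedin T (A <#> B)"
proof (cases "A = {} \<or> B = {}")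
  case True
  then have "A <#> B = {}" by (auto simp: set_mult_def)
  then show ?thesis by simp
next
  case False
  have "compactin (prod_topology T T) (A \<times> B)"
    using assms compact by (simp add: compactin_Times closedin_compact_space)
  moreover have "continuous_map (prod_topology T T) T (\<lambda>(x, y). x \<otimes> y)"
    using topological by (simp add: topological_group_def)
  ultimately have "compactin T ((\<lambda>(x, y). x \<otimes> y) ` (A \<times> B))" by (rule image_compactin)
  moreover have "(\<lambda>(x, y). x \<otimes> y) ` (A \<times> B) = A <#> B" by (auto simp: set_mult_def)
  ultimately show ?thesis using Hausdorff compactin_imp_closedin by metis
qed

section \<open>Closed subgroups of profinite and pro-p groups\<close>

lemma profinite_closed_subgroup:
  assumes P: "subgroup P G" and closed: "closedin T P"
  shows "profinite_group (G\<lparr>carrier := P\<rparr>) (subtopology T P)"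
proof -
  interpret P: subgroup P G by fact
  have ts: "topspace (subtopology T P) = P" using topspace P.subset by (simp add: inf.absorb2)
  have "continuous_map (prod_topology T T) T (\<lambda>(x, y). x \<otimes> y)"
    using topological by (simp add: topological_group_def)
  then have mult: "continuous_map (prod_topology (subtopology T P) (subtopology T P))
      (subtopology T P) (\<lambda>(x, y). x \<otimes> y)"
    unfolding subtopology_Times[symmetric]
    by (intro continuous_map_into_subtopology continuous_map_from_subtopology) auto
  have "continuous_map T T (\<lambda>x. inv x)"
    using topological by (simp add: topological_group_def)
  then have "continuous_map (subtopology T P) (subtopology T P) (\<lambda>x. inv x)"
    by (intro continuous_map_into_subtopology continuous_map_from_subtopology) auto
  then have inv: "continuous_map (subtopology T P) (subtopology T P) (\<lambda>x. inv\<^bsub>G\<lparr>carrier := P\<rparr>\<^esub> x)"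
    by (rule continuous_map_eq) (simp add: ts m_inv_consistent[OF P])
  have "\<exists>K. subgroup K (G\<lparr>carrier := P\<rparr>) \<and> openin (subtopology T P) K \<and> K \<subseteq> U"
    if U: "openin (subtopology T P) U" "\<one> \<in> U" for U
  proof -
    obtain W where W: "openin T W" "U = W \<inter> P" using U(1) by (auto simp: openin_subtopology)
    obtain K where K: "subgroup K G" "openin T K" "K \<subseteq> W"
      using profinite W U(2) unfolding profinite_group_def by blast
    have "subgroup (K \<inter> P) (G\<lparr>carrier := P\<rparr>)"
      using subgroup_incl[OF subgroups_Inter_pair[OF K(1) P] P] by simp
    then show ?thesis
      using K W by (intro exI[of _ "K \<inter> P"]) (auto simp: openin_subtopology)
  qed
  then show ?thesis
    unfolding profinite_group_def topological_group_def
    using mult inv ts subgroup_imp_group[OF P] Hausdorff_space_subtopology[OF Hausdorff]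
      compact_space_subtopology[OF closedin_compact_space[OF compact closed]]
    by simp
qed

text \<open>An open normal \<open>N\<close> of the subgroup contains its intersection with some open
  normal \<open>M\<close> of the whole group. If G/M has order p^k, then all p^k-th powers of the
  subgroup lie in \<open>N\<close>, so the finite quotient by \<open>N\<close> has exponent dividing
  p^k and its order is a power of p.\<close>

lemma pro_p_closed_subgroup:
  assumes pro_p: "pro_p_group p G T" and P: "subgroup P G" and closed: "closedin T P"
  shows "pro_p_group p (G\<lparr>carrier := P\<rparr>) (subtopology T P)"
proof -
  let ?P = "G\<lparr>carrier := P\<rparr>" and ?TP = "subtopology T P"
  have p: "Factorial_Ring.prime p" using pro_p by (simp add: pro_p_group_def)
  have prof: "profinite_group ?P ?TP" by (rule profinite_closed_subgroup[OF P closed])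
  then interpret P: profinite ?P ?TP
    by (simp add: profinite_def profinite_axioms_def top_group_def top_group_axioms_def
        profinite_group_def topological_group_def)
  have "\<exists>k. card (rcosets\<^bsub>?P\<^esub> N) = p ^ k" if N: "N \<lhd> ?P" "openin ?TP N" for N
  proof -
    interpret N: normal N ?P by fact
    obtain W where W: "openin T W" "N = W \<inter> P" using N(2) by (auto simp: openin_subtopology)
    have "\<one> \<in> W" using W(2) N.one_closed by simp
    with W(1) obtain M where M: "M \<lhd> G" "openin T M" "M \<subseteq> W" by (rule open_normal_basis)
    interpret M: normal M G by fact
    interpret GM: group "G Mod M" by (rule M.factorgroup_is_group)
    obtain k where "card (rcosets M) = p ^ k" using pro_p M by (auto simp: pro_p_group_def)
    then have k: "order (G Mod M) = p ^ k" by (simp add: order_def FactGroup_def)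
    have pow: "x [^] (p ^ k) \<in> N" if x: "x \<in> P" for x
    proof -
      have xc: "x \<in> carrier G" using x by (rule subgroup.mem_carrier[OF P])
      have "(M #> x) [^]\<^bsub>G Mod M\<^esub> (p ^ k) = M"
        using GM.pow_order_eq_1[of "M #> x"] k xc by (simp add: carrier_FactGroup)
      then have "M #> x [^] (p ^ k) = M" using xc by (simp add: M.FactGroup_pow)
      then have "x [^] (p ^ k) \<in> M" using rcos_self[OF nat_pow_closed[OF xc] M.subgroup_axioms] by metis
      moreover have "x [^] (p ^ k) \<in> P"
        using P.nat_pow_closed[of x "p ^ k"] x by (simp add: nat_pow_consistent[symmetric])
      ultimately show ?thesis using M(3) W(2) by blast
    qed
    interpret Q: group "?P Mod N" by (rule N.factorgroup_is_group)
    have "finite (carrier (?P Mod N))"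
      using P.finite_rcosets[OF P.compact N(2) N.subgroup_axioms] by (simp add: FactGroup_def)
    moreover have "y [^]\<^bsub>?P Mod N\<^esub> (p ^ k) = \<one>\<^bsub>?P Mod N\<^esub>" if y: "y \<in> carrier (?P Mod N)" for y
    proof -
      obtain x where x: "x \<in> P" "y = N #>\<^bsub>?P\<^esub> x"
        using y unfolding carrier_FactGroup by auto
      have "y [^]\<^bsub>?P Mod N\<^esub> (p ^ k) = N #>\<^bsub>?P\<^esub> (x [^]\<^bsub>?P\<^esub> (p ^ k))"
        unfolding x(2) by (rule N.FactGroup_pow) (simp add: x)
      also have "x [^]\<^bsub>?P\<^esub> (p ^ k) \<in> N" using pow[OF x(1)] by (simp add: nat_pow_consistent[symmetric])
      then have "N #>\<^bsub>?P\<^esub> (x [^]\<^bsub>?P\<^esub> (p ^ k)) = N" by (rule N.rcos_const[OF P.is_group])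
      finally show ?thesis by simp
    qed
    ultimately obtain j where "order (?P Mod N) = p ^ j"
      using Q.order_power_of_exponent_power[OF p] by blast
    then show ?thesis by (auto simp: order_def FactGroup_def)
  qed
  then show ?thesis using p prof by (simp add: pro_p_group_def)
qed

end

section \<open>Pro-2 groups\<close>

context profinite
begin

lemma central_series_set_mult_lower_central:
  assumes "N \<lhd> G"
  shows "central_series G (\<lambda>k. N <#> lower_central G k)"
proof (rule central_series.intro[OF is_group central_series_axioms.intro])
  fix k
  let ?\<Gamma> = "\<lambda>k. N <#> lower_central G k"
  have n: "?\<Gamma> k \<lhd> G" for k
    by (rule normal_subgroup_set_mult_closed[OF assms normal_lower_central])
  then show "?\<Gamma> k \<lhd> G" .
  show "?\<Gamma> (Suc k) \<subseteq> ?\<Gamma> k"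
    by (rule mono_set_mult[OF order_refl lower_central_Suc_subset])
  have sub: "N \<subseteq> ?\<Gamma> (Suc k)" "lower_central G (Suc k) \<subseteq> ?\<Gamma> (Suc k)"
    using subset_set_mult[OF assms normal_imp_subgroup[OF normal_lower_central]] by blast+
  show "?\<Gamma> k \<subseteq> center_mod G (?\<Gamma> (Suc k))"
  proof (rule set_mult_le[OF normal_imp_subgroup[OF normal_center_mod[OF n]]])
    show "N \<subseteq> center_mod G (?\<Gamma> (Suc k))"
      using sub(1) subset_center_mod[OF n] by (rule order_trans)
    show "lower_central G k \<subseteq> center_mod G (?\<Gamma> (Suc k))"
      using lower_central_subset_center_mod centralizer_mod_mono[OF sub(2)] by (rule order_trans)
  qed
qed

text \<open>Powerfulness of G/Z speaks of a closure in the quotient topology. Being open,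
  \<open>D\<close> absorbs that closure: the image of D c is a neighbourhood of the coset of c, so
  it meets the group generated by the fourth powers, which lies in the image of \<open>D\<close>.
  Since \<open>Z\<close> is contained in \<open>D\<close>, the relation lifts to c in
  \<open>D\<close>.\<close>

lemma commutator_mem_of_powerful_quotient:
  assumes Z: "Z \<lhd> G" and pow: "powerful (G Mod Z) (Mod_topology G T Z)"
    and D: "subgroup D G" "openin T D" "Z \<subseteq> D" "\<And>x. x \<in> carrier G \<Longrightarrow> x [^] (4::nat) \<in> D"
    and a: "a \<in> carrier G" and b: "b \<in> carrier G"
  shows "commutator a b \<in> D"
proof -
  interpret Z: normal Z G by fact
  interpret Q: group "G Mod Z" by (rule Z.factorgroup_is_group)
  let ?q = "\<lambda>x. Z #> x"
  interpret q: group_hom G "G Mod Z" ?q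
    by (simp add: group_hom_def group_hom_axioms_def is_group Q.is_group Z.r_coset_hom_Mod)
  define c where "c = commutator a b"
  have c: "c \<in> carrier G" using a b by (simp add: c_def)
  have "?q c = ?q a \<otimes>\<^bsub>G Mod Z\<^esub> ?q b \<otimes>\<^bsub>G Mod Z\<^esub> inv\<^bsub>G Mod Z\<^esub> ?q a \<otimes>\<^bsub>G Mod Z\<^esub> inv\<^bsub>G Mod Z\<^esub> ?q b"
    unfolding c_def using a b by (simp add: q.hom_mult q.hom_inv del: mult_FactGroup)
  then have "?q c \<in> commutator_subgroup (G Mod Z) (carrier (G Mod Z)) (carrier (G Mod Z))"
    using Q.commutator_in_commutator_subgroup[of "?q a" _ "?q b"] a b by simp
  then have "?q c \<in> Mod_topology G T Z closure_of power_subgroup (G Mod Z) (carrier (G Mod Z)) 4"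
    using pow unfolding powerful_def by (rule subsetD[rotated])
  moreover
  let ?U = "?q ` (D #> c)"
  have Dc: "D #> c \<subseteq> carrier G" by (rule r_coset_subset_G[OF subgroup.subset[OF D(1)] c])
  have "openin (Mod_topology G T Z) ?U"
  proof -
    \<comment> \<open>D c is a union of cosets of \<open>Z\<close>, so its image is open for the
      quotient topology.\<close>
    have "{x \<in> carrier G. ?q x \<in> ?U} = D #> c"
    proof
      show "D #> c \<subseteq> {x \<in> carrier G. ?q x \<in> ?U}" using Dc by auto
      show "{x \<in> carrier G. ?q x \<in> ?U} \<subseteq> D #> c"
      proof
        fix x assume "x \<in> {x \<in> carrier G. ?q x \<in> ?U}"
        then obtain d where d: "d \<in> D" and x: "x \<in> carrier G" "?q x = ?q (d \<otimes> c)"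
          by (auto simp: r_coset_def)
        have "x \<in> ?q (d \<otimes> c)" using rcos_self[OF x(1) Z.subgroup_axioms] x(2) by simp
        then obtain z where z: "z \<in> Z" "x = z \<otimes> (d \<otimes> c)" unfolding r_coset_def by blast
        have "x = (z \<otimes> d) \<otimes> c"
          using z c subgroup.mem_carrier[OF D(1) d] by (simp add: m_assoc)
        moreover have "z \<otimes> d \<in> D" using subgroup.m_closed[OF D(1) _ d] D(3) z(1) by blast
        ultimately show "x \<in> D #> c" unfolding r_coset_def by blast
      qed
    qed
    then show ?thesis
      using open_rcoset[OF D(2) c] Dc
      unfolding Mod_topology_def openin_quotient_topology topspace by auto
  qed
  moreover have "?q c \<in> ?U" using rcos_self[OF c D(1)] by simp
  ultimately obtain y where y: "y \<in> power_subgroup (G Mod Z) (carrier (G Mod Z)) 4" "y \<in> ?U"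
    unfolding in_closure_of by metis
  have "power_subgroup (G Mod Z) (carrier (G Mod Z)) 4 \<subseteq> ?q ` D"
    unfolding power_subgroup_def
  proof (rule Q.generate_subgroup_incl[OF _ q.subgroup_img_is_subgroup[OF D(1)]])
    show "(\<lambda>x. x [^]\<^bsub>G Mod Z\<^esub> (4::nat)) ` carrier (G Mod Z) \<subseteq> ?q ` D"
      using D(4) by (auto simp: carrier_FactGroup Z.FactGroup_pow)
  qed
  with y obtain d where d: "d \<in> D" "y = ?q d" by blast
  from y(2) obtain d' where d': "d' \<in> D" "y = ?q (d' \<otimes> c)" by (auto simp: r_coset_def)
  have dc: "d \<in> carrier G" "d' \<in> carrier G" using subgroup.mem_carrier[OF D(1)] d d' by blast+
  have "d' \<otimes> c \<in> ?q d"
    using rcos_self[of "d' \<otimes> c" Z] Z.subgroup_axioms dc c d(2) d'(2) by simp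
  then obtain z where z: "z \<in> Z" "d' \<otimes> c = z \<otimes> d" unfolding r_coset_def by blast
  have "inv d' \<otimes> (d' \<otimes> c) \<in> D"
    unfolding z(2) using z(1) D(3)
    by (intro subgroup.m_closed[OF D(1)] subgroup.m_inv_closed[OF D(1)] d(1) d'(1)) auto
  then show ?thesis using dc c by (simp add: inv_mult_cancel c_def)
qed

end

locale pro_2_group = profinite +
  assumes pro_2: "pro_p_group 2 G T"
begin

text \<open>A central element of order 2 in the nontrivial finite 2-group G/K is lifted to
  \<open>G\<close>. It makes \<open>exp2_center_mod\<close> strictly increase from any proper open
  normal subgroup.\<close>

lemma exp2_center_mod_nontrivial:
  assumes K: "K \<lhd> G" "openin T K" and proper: "K \<noteq> carrier G"
  shows "\<exists>x \<in> exp2_center_mod G K. x \<notin> K"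
proof -
  interpret K: normal K G by fact
  interpret Q: group "G Mod K" by (rule K.factorgroup_is_group)
  obtain k where "card (rcosets K) = 2 ^ k" using pro_2 K by (auto simp: pro_p_group_def)
  then have k: "order (G Mod K) = 2 ^ k" by (simp add: order_def FactGroup_def)
  have "k > 0"
  proof (rule ccontr)
    assume "\<not> k > 0"
    then have "carrier (G Mod K) = {\<one>\<^bsub>G Mod K\<^esub>}"
      using k Q.order_one_triv_iff by simp
    then have "K #> x = K" if "x \<in> carrier G" for x
      using that by (auto simp: carrier_FactGroup)
    then have "carrier G \<subseteq> K" using rcos_self[OF _ K.subgroup_axioms] by blast
    then show False using proper K.subset by blast
  qed
  then obtain z where z: "z \<in> group_center (G Mod K)" "z \<noteq> K" "z [^]\<^bsub>G Mod K\<^esub> (2::nat) = K"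
    using Q.central_element_of_order_p[OF two_is_prime_nat k] by auto
  then obtain x where x: "x \<in> carrier G" "z = K #> x"
    by (auto simp: group_center_def carrier_FactGroup)
  have "x \<in> center_mod G K" using z(1) x center_mod_eq[OF K(1)] by blast
  moreover have "K #> (x \<otimes> x) = K"
    using z(3) x by (simp add: K.FactGroup_pow pow_two)
  then have "x \<otimes> x \<in> K" using rcos_self[OF _ K.subgroup_axioms, of "x \<otimes> x"] x(1) by simp
  moreover have "x \<notin> K" using z(2) x(2) K.rcos_const[OF is_group] by blast
  ultimately show ?thesis by (auto simp: exp2_center_mod_def)
qed

text \<open>A Nakayama lemma: the hypothesis holds if \<open>M \<subseteq> K M\<^sup>2 [M, G]\<close>.\<close>

lemma subset_open_normal_subgroupI:
  assumes K: "K \<lhd> G" "openin T K" and M: "M \<subseteq> carrier G"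
    and step: "\<And>L. L \<lhd> G \<Longrightarrow> K \<subseteq> L \<Longrightarrow> M \<subseteq> exp2_center_mod G L \<Longrightarrow> M \<subseteq> L"
  shows "M \<subseteq> K"
proof -
  have KG: "subgroup K G" by (rule normal_imp_subgroup[OF K(1)])
  have fin: "finite (rcosets K)" by (rule finite_rcosets[OF compact K(2) KG])
  have "M \<subseteq> L" if "L \<lhd> G" "K \<subseteq> L" for L
    using that
  \<comment> \<open>Downward from the whole group: \<open>L\<close> is enlarged to
    \<open>exp2_center_mod G L\<close>, which leaves fewer cosets of \<open>K\<close> outside; the
    induction hypothesis places \<open>M\<close> in the larger group, and \<open>step\<close> brings
    it back into \<open>L\<close>.\<close>
  proof (induction "card {C \<in> rcosets K. \<not> C \<subseteq> L}" arbitrary: L rule: less_induct)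
    case less
    show ?case
    proof (cases "L = carrier G")
      case False
      let ?E = "exp2_center_mod G L"
      have LG: "subgroup L G" by (rule normal_imp_subgroup[OF less.prems(1)])
      have "openin T L" by (rule open_supergroup[OF K(2) KG LG less.prems(2)])
      then obtain x where x: "x \<in> ?E" "x \<notin> L"
        using exp2_center_mod_nontrivial less.prems(1) False by blast
      have LE: "L \<subseteq> ?E" by (rule subset_exp2_center_mod[OF less.prems(1)])
      have En: "?E \<lhd> G" by (rule normal_exp2_center_mod[OF less.prems(1)])
      have xc: "x \<in> carrier G" by (rule subgroup.mem_carrier[OF normal_imp_subgroup[OF En] x(1)])
      have "K #> x \<in> rcosets K" using subgroup.subset[OF KG] xc by (rule rcosetsI)
      moreover have "K #> x \<subseteq> ?E"
        using less.prems(2) LE x(1) subgroup.m_closed[OF normal_imp_subgroup[OF En]]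
        by (auto simp: r_coset_def)
      moreover have "\<not> K #> x \<subseteq> L" using x(2) rcos_self[OF xc KG] by blast
      ultimately have "{C \<in> rcosets K. \<not> C \<subseteq> ?E} \<subset> {C \<in> rcosets K. \<not> C \<subseteq> L}"
        using LE by blast
      then have "card {C \<in> rcosets K. \<not> C \<subseteq> ?E} < card {C \<in> rcosets K. \<not> C \<subseteq> L}"
        using fin by (intro psubset_card_mono) auto
      then have "M \<subseteq> ?E" using En less.prems(2) LE by (intro less.hyps) auto
      then show ?thesis using step less.prems by simp
    qed (use M in simp)
  qed
  then show ?thesis using K(1) by simp
qed

section \<open>Powerful embedding of the lower central series\<close>

lemma lower_central_Suc_le_powers:
  assumes pow: "powerful (G Mod nth_center G i) (Mod_topology G T (nth_center G i))"
    and N: "N \<lhd> G" "openin T N"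
  shows "lower_central G (Suc (Suc i)) \<subseteq> N <#> power_subgroup G (lower_central G (Suc i)) 4"
    (is "?M \<subseteq> ?K")
proof -
  let ?\<Gamma> = "\<lambda>k. N <#> lower_central G k"
  interpret central_series G ?\<Gamma> by (rule central_series_set_mult_lower_central[OF N(1)])
  have NG: "subgroup N G" by (rule normal_imp_subgroup[OF N(1)])
  have lcG: "subgroup (lower_central G k) G" for k
    by (rule normal_imp_subgroup[OF normal_lower_central])
  let ?L = "S 2 (Suc i)"
  \<comment> \<open>Here \<open>i\<close> is n - 1. A fourth power lies in \<open>S 2 1\<close>, and
    i commutations with the group shift this to \<open>S 2 (Suc i)\<close>; hence i applications of
    \<open>center_mod\<close>, which also cover the i-th centre.\<close>
  let ?D = "(center_mod G ^^ i) ?L"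
  have L: "?L \<lhd> G" by (rule normal_mixed_powers)
  have D: "subgroup ?D G" by (rule normal_imp_subgroup[OF normal_center_mod_iter[OF L]])
  have "N \<subseteq> ?\<Gamma> (Suc i + 2)" by (rule subset_set_mult[OF N(1) lcG])
  also have "\<dots> \<subseteq> ?L" by (rule series_subset_mixed_powers)
  also have "\<dots> \<subseteq> ?D" by (rule subset_center_mod_iter[OF L])
  finally have openD: "openin T ?D" using open_supergroup[OF N(2) NG D] by simp
  have pow4: "x [^] (4::nat) \<in> ?D" if x: "x \<in> carrier G" for x
  proof -
    have "x \<in> ?\<Gamma> (Suc 0)"
      using subset_set_mult(2)[OF N(1) lcG, of "Suc 0"] x by auto
    from pow_in_mixed_powers[OF this, of 2] mixed_powers_center_mod_iter[of 2 "Suc 0" i]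
    show ?thesis by auto
  qed
  have "commutator a b \<in> ?D" if "a \<in> carrier G" "b \<in> carrier G" for a b
    by (rule commutator_mem_of_powerful_quotient[OF normal_nth_center pow D openD
          nth_center_subset_center_mod_iter[OF L] pow4 that])
  then have "lower_central G (Suc (Suc 0)) \<subseteq> ?D"
    using commutator_subgroup_le[OF D] by simp
  from lower_central_le_of_center_mod_iter[OF L this] have MS: "?M \<subseteq> ?L" by simp
  have Kn: "power_subgroup G (lower_central G (Suc i)) 4 \<lhd> G"
    by (rule normal_power_subgroup[OF normal_lower_central])
  have K: "?K \<lhd> G" by (rule normal_subgroup_set_mult_closed[OF N(1) Kn])
  have NK: "N \<subseteq> ?K" and PK: "power_subgroup G (lower_central G (Suc i)) 4 \<subseteq> ?K"
    using subset_set_mult[OF N(1) normal_imp_subgroup[OF Kn]] by blast+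
  have openK: "openin T ?K" by (rule open_supergroup[OF N(2) NG normal_imp_subgroup[OF K] NK])
  show ?thesis
  proof (rule subset_open_normal_subgroupI[OF K openK subgroup.subset[OF lcG]])
    fix L' assume L': "L' \<lhd> G" "?K \<subseteq> L'" and M: "?M \<subseteq> exp2_center_mod G L'"
    have L'G: "subgroup L' G" by (rule normal_imp_subgroup[OF L'(1)])
    have NL': "N \<subseteq> L'" using NK L'(2) by (rule order_trans)
    \<comment> \<open>Factor by factor: the fourth powers of gamma_n lie in \<open>?K\<close>; the
      squares of gamma_(n+1) and the group gamma_(n+2) = [gamma_(n+1), G] lie in \<open>L'\<close>
      by the two clauses of \<open>exp2_center_mod\<close>.\<close>
    have "?L \<subseteq> L'"
    proof (rule mixed_powers_le[OF L'G])
      fix l x assume l: "l \<le> 2" and x: "x \<in> ?\<Gamma> (Suc i + l)"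
      show "x [^] (2 ^ (2 - l) :: nat) \<in> L'"
      proof (rule pow_mem_of_set_mult[OF N(1) L'G NL' subgroup.subset[OF lcG] x])
        fix a assume a: "a \<in> lower_central G (Suc i + l)"
        have ac: "a \<in> carrier G" by (rule subgroup.mem_carrier[OF lcG a])
        consider "l = 0" | "l = 1" | "l = 2" using l by linarith
        then show "a [^] (2 ^ (2 - l) :: nat) \<in> L'"
        proof cases
          case 1
          then have "a [^] (4::nat) \<in> power_subgroup G (lower_central G (Suc i)) 4"
            using a by (auto simp: power_subgroup_def intro: generate.incl)
          then show ?thesis using 1 PK L'(2) by auto
        next
          case 2
          then have "a \<otimes> a \<in> L'" using a M by (auto simp: exp2_center_mod_def)
          then show ?thesis using 2 ac by (simp add: pow_two)
        next
          case 3
          have "lower_central G (Suc (Suc (Suc i))) \<subseteq> L'"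
            unfolding lower_central.simps(3)[of _ "Suc i"]
          proof (rule commutator_subgroup_le[OF L'G])
            fix y g assume "y \<in> ?M" "g \<in> carrier G"
            moreover have "?M \<subseteq> center_mod G L'" using M by (auto simp: exp2_center_mod_def)
            ultimately show "commutator y g \<in> L'" by (auto simp: centralizer_mod_def)
          qed
          then show ?thesis using 3 a ac by (auto simp del: lower_central.simps)
        qed
      qed
    qed
    then show "?M \<subseteq> L'" using MS by (rule order_trans[rotated])
  qed
qed

text \<open>A point of the closure lies in N gamma_n for each open normal \<open>N\<close>, and both
  \<open>N\<close> and gamma_n are central modulo N times the fourth powers of the closure.\<close>

lemma closure_lower_central_powerfully_embedded:
  assumes "powerful (G Mod nth_center G i) (Mod_topology G T (nth_center G i))"
  shows "powerfully_embedded (T closure_of lower_central G (Suc i)) G T"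
proof -
  let ?\<gamma> = "lower_central G (Suc i)"
  let ?C = "T closure_of ?\<gamma>"
  let ?P = "power_subgroup G ?C 4"
  have \<gamma>: "subgroup ?\<gamma> G" by (rule normal_imp_subgroup[OF normal_lower_central])
  have C: "?C \<lhd> G" by (rule normal_closure[OF normal_lower_central])
  have P: "?P \<lhd> G" by (rule normal_power_subgroup[OF C])
  have PG: "subgroup ?P G" by (rule normal_imp_subgroup[OF P])
  have "?\<gamma> \<subseteq> ?C" by (rule closure_of_subset) (use subgroup.subset[OF \<gamma>] topspace in simp)
  then have "power_subgroup G ?\<gamma> 4 \<subseteq> ?P"
    unfolding power_subgroup_def by (intro mono_generate) auto
  have "commutator x g \<in> T closure_of ?P" if x: "x \<in> ?C" and g: "g \<in> carrier G" for x g
    unfolding mem_closure_iff[OF subgroup.subset[OF PG]]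
  proof (intro conjI allI impI)
    have xc: "x \<in> carrier G" by (rule subgroup.mem_carrier[OF normal_imp_subgroup[OF C] x])
    then show "commutator x g \<in> carrier G" using g by simp
    fix N assume N: "N \<lhd> G \<and> openin T N"
    then have Nn: "N \<lhd> G" by simp
    let ?K = "N <#> ?P"
    have K: "?K \<lhd> G" by (rule normal_subgroup_set_mult_closed[OF Nn P])
    have NK: "N \<subseteq> ?K" by (rule subset_set_mult[OF Nn PG])
    have "N <#> power_subgroup G ?\<gamma> 4 \<subseteq> ?K"
      by (rule mono_set_mult[OF order_refl \<open>power_subgroup G ?\<gamma> 4 \<subseteq> ?P\<close>])
    then have "lower_central G (Suc (Suc i)) \<subseteq> ?K"
      using lower_central_Suc_le_powers[OF assms] N by (meson order_trans)
    then have "?\<gamma> \<subseteq> center_mod G ?K"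
      using lower_central_subset_center_mod[of "Suc i"] centralizer_mod_mono by (meson order_trans)
    moreover have "N \<subseteq> center_mod G ?K"
      using NK subset_center_mod[OF K] by (rule order_trans)
    ultimately have "N <#> ?\<gamma> \<subseteq> center_mod G ?K"
      by (intro set_mult_le normal_imp_subgroup normal_center_mod K)
    moreover have "x \<in> N <#> ?\<gamma>"
      using x N mem_closure_iff[OF subgroup.subset[OF \<gamma>]] by simp
    ultimately show "commutator x g \<in> ?K" using g by (auto simp: centralizer_mod_def)
  qed
  then have "commutator_subgroup G ?C (carrier G) \<subseteq> T closure_of ?P"
    by (intro commutator_subgroup_le normal_imp_subgroup normal_closure P)
  then show ?thesis using C by (simp add: powerfully_embedded_def)
qed

subsection \<open>The lower 2-series\<close>

abbreviation "P \<equiv> lower_p_series 2 G T"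

lemma closed_normal_lower_2_series: "P k \<lhd> G \<and> closedin T (P k)"
proof (induction k)
  case 0
  show ?case using carrier_normal topspace closedin_topspace[of T] by simp
next
  case (Suc k)
  show ?case
  proof (cases k)
    case 0
    then show ?thesis using carrier_normal topspace closedin_topspace[of T] by simp
  next
    case (Suc j)
    with Suc.IH have "P (Suc j) \<lhd> G" by simp
    then show ?thesis unfolding Suc lower_p_series.simps(3)
      by (intro conjI closed_set_mult closedin_closure_of normal_subgroup_set_mult_closed
          normal_closure normal_power_subgroup normal_commutator_subgroup)
  qed
qed

lemma normal_lower_2_series: "P k \<lhd> G"
  and closed_lower_2_series: "closedin T (P k)"
  using closed_normal_lower_2_series by auto

lemma subgroup_lower_2_series: "subgroup (P k) G"
  by (rule normal_imp_subgroup[OF normal_lower_2_series])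

lemma square_and_commutator_in_lower_2_series:
  assumes x: "x \<in> P (Suc k)"
  shows "x \<otimes> x \<in> P (Suc (Suc k))" "g \<in> carrier G \<Longrightarrow> commutator x g \<in> P (Suc (Suc k))"
proof -
  let ?A = "power_subgroup G (P (Suc k)) 2" and ?B = "commutator_subgroup G (P (Suc k)) (carrier G)"
  have A: "?A \<lhd> G" by (rule normal_power_subgroup[OF normal_lower_2_series])
  have B: "?B \<lhd> G" by (rule normal_commutator_subgroup[OF normal_lower_2_series])
  have cl: "?A \<subseteq> T closure_of ?A" "?B \<subseteq> T closure_of ?B"
    using subgroup.subset[OF normal_imp_subgroup[OF A]] subgroup.subset[OF normal_imp_subgroup[OF B]]
    by (simp_all add: closure_of_subset topspace)
  have le: "T closure_of ?A \<subseteq> P (Suc (Suc k))" "T closure_of ?B \<subseteq> P (Suc (Suc k))"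
    unfolding lower_p_series.simps(3)
    by (rule subset_set_mult[OF normal_closure[OF A] normal_imp_subgroup[OF normal_closure[OF B]]])+
  note sub = order_trans[OF cl(1) le(1)] order_trans[OF cl(2) le(2)]
  have "x \<in> carrier G" by (rule subgroup.mem_carrier[OF subgroup_lower_2_series x])
  then have "x \<otimes> x \<in> ?A"
    using x by (auto simp: power_subgroup_def simp flip: pow_two intro: generate.incl)
  then show "x \<otimes> x \<in> P (Suc (Suc k))" using sub(1) by (rule subsetD[rotated])
  assume "g \<in> carrier G"
  with x have "commutator x g \<in> ?B" by (rule commutator_in_commutator_subgroup)
  then show "commutator x g \<in> P (Suc (Suc k))" using sub(2) by (rule subsetD[rotated])
qed

text \<open>Together with the preceding lemma this describes the next term as the least closed
  subgroup containing the squares and the commutators with \<open>G\<close>, so the product of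
  closures need not be unfolded again.\<close>

lemma lower_2_series_Suc_le:
  assumes K: "subgroup K G" "closedin T K"
    and sq: "\<And>x. x \<in> P (Suc k) \<Longrightarrow> x \<otimes> x \<in> K"
    and comm: "\<And>x g. x \<in> P (Suc k) \<Longrightarrow> g \<in> carrier G \<Longrightarrow> commutator x g \<in> K"
  shows "P (Suc (Suc k)) \<subseteq> K"
  unfolding lower_p_series.simps(3)
proof (rule set_mult_le[OF K(1)])
  have "power_subgroup G (P (Suc k)) 2 \<subseteq> K"
    unfolding power_subgroup_def
  proof (rule generate_subgroup_incl[OF _ K(1)], rule image_subsetI)
    fix x assume x: "x \<in> P (Suc k)"
    then have "x \<in> carrier G" by (rule subgroup.mem_carrier[OF subgroup_lower_2_series])
    then show "x [^] (2::nat) \<in> K" using sq[OF x] by (simp add: pow_two)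
  qed
  then show "T closure_of power_subgroup G (P (Suc k)) 2 \<subseteq> K"
    using K(2) by (rule closure_of_minimal)
  have "commutator_subgroup G (P (Suc k)) (carrier G) \<subseteq> K"
    by (rule commutator_subgroup_le[OF K(1) comm])
  then show "T closure_of commutator_subgroup G (P (Suc k)) (carrier G) \<subseteq> K"
    using K(2) by (rule closure_of_minimal)
qed

lemma lower_2_series_Suc_subset: "P (Suc (Suc k)) \<subseteq> P (Suc k)"
proof (rule lower_2_series_Suc_le[OF subgroup_lower_2_series closed_lower_2_series])
  fix x assume x: "x \<in> P (Suc k)"
  then show "x \<otimes> x \<in> P (Suc k)" by (intro subgroup.m_closed[OF subgroup_lower_2_series])
  fix g assume "g \<in> carrier G"
  then show "commutator x g \<in> P (Suc k)" by (rule normal_commutator(1)[OF normal_lower_2_series x])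
qed

lemma lower_2_series_subset_second: "P (Suc (Suc k)) \<subseteq> P (Suc (Suc 0))"
  by (induction k) (auto simp del: lower_p_series.simps dest: subsetD[OF lower_2_series_Suc_subset])

lemma lower_central_subset_lower_2_series: "lower_central G (Suc k) \<subseteq> P (Suc k)"
proof (induction k)
  case (Suc k)
  show ?case unfolding lower_central.simps(3)
    by (rule commutator_subgroup_le[OF subgroup_lower_2_series])
      (use Suc.IH square_and_commutator_in_lower_2_series(2) in blast)
qed simp

lemma pow_in_lower_2_series: "x \<in> P (Suc k) \<Longrightarrow> x [^] (2 ^ s :: nat) \<in> P (Suc (k + s))"
proof (induction s)
  case 0
  then show ?case using subgroup.mem_carrier[OF subgroup_lower_2_series] by simp
next
  case (Suc s)
  have "x \<in> carrier G" by (rule subgroup.mem_carrier[OF subgroup_lower_2_series Suc.prems])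
  then have "x [^] (2 ^ Suc s :: nat) = x [^] (2 ^ s :: nat) \<otimes> x [^] (2 ^ s :: nat)"
    by (simp add: nat_pow_mult mult_2)
  then show ?case
    using square_and_commutator_in_lower_2_series(1)[OF Suc.IH[OF Suc.prems]] by simp
qed

text \<open>The form of powerfulness of P_n, n = i + 1, at a single open normal \<open>N\<close>;
  intersecting over \<open>N\<close> then gives the closure.\<close>

lemma commutator_in_lower_2_series_powers:
  assumes pow: "powerful (G Mod nth_center G i) (Mod_topology G T (nth_center G i))"
    and N: "N \<lhd> G" "openin T N"
    and a: "a \<in> P (Suc i)" and b: "b \<in> P (Suc i)"
  shows "commutator a b \<in> N <#> power_subgroup G (P (Suc i)) 4" (is "_ \<in> ?K")
proof -
  let ?\<Gamma> = "\<lambda>k. N <#> lower_central G k"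
  interpret central_series G ?\<Gamma> by (rule central_series_set_mult_lower_central[OF N(1)])
  have NG: "subgroup N G" by (rule normal_imp_subgroup[OF N(1)])
  have lcG: "subgroup (lower_central G k) G" for k
    by (rule normal_imp_subgroup[OF normal_lower_central])
  have Pn: "subgroup (power_subgroup G (P (Suc i)) 4) G"
    by (rule normal_imp_subgroup[OF normal_power_subgroup[OF normal_lower_2_series]])
  have K: "subgroup ?K G" by (rule subgroup_set_mult[OF N(1) Pn])
  have NK: "N \<subseteq> ?K" and PK: "power_subgroup G (P (Suc i)) 4 \<subseteq> ?K"
    using subset_set_mult[OF N(1) Pn] by blast+
  have "power_subgroup G (lower_central G (Suc i)) 4 \<subseteq> power_subgroup G (P (Suc i)) 4"
    unfolding power_subgroup_def
    by (intro mono_generate image_mono lower_central_subset_lower_2_series)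
  then have "N <#> power_subgroup G (lower_central G (Suc i)) 4 \<subseteq> ?K"
    by (rule mono_set_mult[OF order_refl])
  then have lcK: "lower_central G (Suc (Suc i)) \<subseteq> ?K"
    by (rule order_trans[OF lower_central_Suc_le_powers[OF pow N]])
  show ?thesis
  proof (cases i)
    case 0
    then have "commutator a b \<in> lower_central G (Suc (Suc i))"
      using a b by (auto intro: commutator_in_commutator_subgroup)
    then show ?thesis using lcK by (rule subsetD[rotated])
  next
    case (Suc j)
    have NS: "N \<subseteq> S r k" for r k
      by (rule order_trans[OF subset_set_mult(1)[OF N(1) lcG] series_subset_mixed_powers])
    \<comment> \<open>Closedness is what allows \<open>lower_2_series_Suc_le\<close> to bound terms
      of the 2-series; it comes from the factor \<open>N\<close>.\<close>
    have closedS: "closedin T (S r k)" for r k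
      by (rule open_subgroup_closed[OF open_supergroup[OF N(2) NG subgroup_mixed_powers NS]
            subgroup_mixed_powers])
    have PS: "P (Suc m) \<subseteq> S m (Suc 0)" for m
    proof (induction m)
      case 0
      show ?case using subset_set_mult(2)[OF N(1) lcG, of "Suc 0"] by simp
    next
      case (Suc m)
      then have "P (Suc m) \<subseteq> exp2_center_mod G (S (Suc m) (Suc 0))"
        using mixed_powers_exp2_central by (rule order_trans)
      then show ?case
        by (intro lower_2_series_Suc_le[OF subgroup_mixed_powers closedS])
          (auto simp: exp2_center_mod_def centralizer_mod_def simp del: mixed_powers.simps)
    qed
    let ?C = "centralizer_mod G (S (Suc j) (Suc 0)) (S (Suc (Suc (Suc j))) (Suc 0))"
    have C: "subgroup ?C G"
      by (rule subgroup_centralizer_mod[OF normal_mixed_powers mixed_powers_carrier])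
    have "N \<subseteq> ?C"
      by (rule order_trans[OF NS subset_centralizer_mod[OF normal_mixed_powers mixed_powers_carrier]])
    then have "closedin T ?C"
      by (rule open_subgroup_closed[OF open_supergroup[OF N(2) NG C] C])
    then have "P (Suc (Suc 0)) \<subseteq> ?C"
      by (rule lower_2_series_Suc_le[OF C])
        (simp_all add: square_centralizes_mixed_powers commutator_centralizes_mixed_powers
          del: mixed_powers.simps)
    \<comment> \<open>The two arguments are used differently: \<open>a\<close> only as an element of
      P_2, \<open>b\<close> as an element of S(n-1,1), where n = j + 2.\<close>
    then have "a \<in> ?C" using a lower_2_series_subset_second unfolding Suc by blast
    moreover have "b \<in> S (Suc j) (Suc 0)" using b PS unfolding Suc by blast
    ultimately have "commutator a b \<in> S (Suc (Suc (Suc j))) (Suc 0)"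
      unfolding centralizer_mod_def by blast
    moreover have "S (Suc (Suc (Suc j))) (Suc 0) \<subseteq> ?K"
    proof (rule mixed_powers_le[OF K])
      fix l x assume l: "l \<le> Suc (Suc (Suc j))" and x: "x \<in> ?\<Gamma> (Suc 0 + l)"
      show "x [^] (2 ^ (Suc (Suc (Suc j)) - l) :: nat) \<in> ?K"
      proof (rule pow_mem_of_set_mult[OF N(1) K NK subgroup.subset[OF lcG] x])
        fix y assume "y \<in> lower_central G (Suc 0 + l)"
        then have y: "y \<in> lower_central G (Suc l)" by simp
        have yc: "y \<in> carrier G" by (rule subgroup.mem_carrier[OF lcG y])
        show "y [^] (2 ^ (Suc (Suc (Suc j)) - l) :: nat) \<in> ?K"
        proof (cases "l \<le> Suc j")
          case True
          have "y \<in> P (Suc l)" using y lower_central_subset_lower_2_series by blast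
          from pow_in_lower_2_series[OF this, of "Suc j - l"]
          have "y [^] (2 ^ (Suc j - l) :: nat) \<in> P (Suc i)" using True Suc by simp
          then have "(y [^] (2 ^ (Suc j - l) :: nat)) [^] (4::nat) \<in> power_subgroup G (P (Suc i)) 4"
            by (auto simp: power_subgroup_def intro: generate.incl)
          \<comment> \<open>The first n - 1 - l squarings carry P_(l+1) into P_n; the two that are
            left give the exponent 4.\<close>
          moreover have "(2::nat) ^ (Suc (Suc (Suc j)) - l) = 2 ^ (Suc j - l) * 4"
            using True by (simp add: Suc_diff_le)
          ultimately show ?thesis using PK yc by (auto simp: nat_pow_pow)
        next
          case False
          then consider "l = Suc (Suc j)" | "l = Suc (Suc (Suc j))" using l by linarith
          then have "y \<in> lower_central G (Suc (Suc i))"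
          proof cases
            case 1
            then show ?thesis using y Suc by simp
          next
            case 2
            then show ?thesis using y Suc lower_central_Suc_subset by blast
          qed
          then have "y \<in> ?K" using lcK by blast
          then have "y [^]\<^bsub>G\<lparr>carrier := ?K\<rparr>\<^esub> m \<in> ?K" for m :: nat
            using monoid.nat_pow_closed[OF group.is_monoid[OF subgroup_imp_group[OF K]], of y m]
            by simp
          then show ?thesis by (simp add: nat_pow_consistent[symmetric])
        qed
      qed
    qed
    ultimately show ?thesis by blast
  qed
qed

text \<open>Power and commutator subgroups agree whether computed in P_n or in \<open>G\<close>, and
  a closure in the subspace is the trace on P_n of the closure in \<open>G\<close>, so everything
  can be checked in \<open>G\<close>.\<close>

lemma lower_2_series_powerful:
  assumes pow: "powerful (G Mod nth_center G i) (Mod_topology G T (nth_center G i))"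
  shows "powerful (G\<lparr>carrier := P (Suc i)\<rparr>) (subtopology T (P (Suc i)))"
proof -
  let ?P = "P (Suc i)" and ?W = "power_subgroup G (P (Suc i)) 4"
  have P: "subgroup ?P G" by (rule subgroup_lower_2_series)
  have Wn: "?W \<lhd> G" by (rule normal_power_subgroup[OF normal_lower_2_series])
  have W: "subgroup ?W G" by (rule normal_imp_subgroup[OF Wn])
  have pow_P: "x [^] (4::nat) \<in> ?P" if "x \<in> ?P" for x
    using monoid.nat_pow_closed[OF group.is_monoid[OF subgroup_imp_group[OF P]], of x 4] that
    by (simp add: nat_pow_consistent[symmetric])
  then have pows: "(\<lambda>x. x [^] (4::nat)) ` ?P \<subseteq> ?P" by blast
  then have WP: "?W \<subseteq> ?P" unfolding power_subgroup_def by (rule generate_subgroup_incl[OF _ P])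
  have comm_P: "commutator a b \<in> ?P" if "a \<in> ?P" "b \<in> ?P" for a b
    using that by (intro subgroup.m_closed[OF P] subgroup.m_inv_closed[OF P])
  have "power_subgroup (G\<lparr>carrier := ?P\<rparr>) ?P 4 = ?W"
    unfolding power_subgroup_def using generate_consistent[OF pows P]
    by (simp add: nat_pow_consistent[symmetric])
  moreover have "commutator_subgroup (G\<lparr>carrier := ?P\<rparr>) ?P ?P = commutator_subgroup G ?P ?P"
  proof -
    have "(\<Union>a\<in>?P. \<Union>b\<in>?P. {a \<otimes> b \<otimes> inv\<^bsub>G\<lparr>carrier := ?P\<rparr>\<^esub> a \<otimes> inv\<^bsub>G\<lparr>carrier := ?P\<rparr>\<^esub> b})
        = (\<Union>a\<in>?P. \<Union>b\<in>?P. {commutator a b})"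
      using m_inv_consistent[OF P] by simp
    moreover have "(\<Union>a\<in>?P. \<Union>b\<in>?P. {commutator a b}) \<subseteq> ?P" using comm_P by blast
    ultimately show ?thesis
      unfolding commutator_subgroup_def using generate_consistent[OF _ P] by simp
  qed
  moreover have "commutator_subgroup G ?P ?P \<subseteq> ?P"
    by (rule commutator_subgroup_le[OF P comm_P])
  moreover have "commutator_subgroup G ?P ?P \<subseteq> T closure_of ?W"
  proof (rule commutator_subgroup_le[OF normal_imp_subgroup[OF normal_closure[OF Wn]]])
    fix a b assume ab: "a \<in> ?P" "b \<in> ?P"
    have "commutator a b \<in> carrier G" using comm_P[OF ab] by (rule subgroup.mem_carrier[OF P])
    then show "commutator a b \<in> T closure_of ?W"
      unfolding mem_closure_iff[OF subgroup.subset[OF W]]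
      using commutator_in_lower_2_series_powers[OF pow _ _ ab] by simp
  qed
  ultimately show ?thesis
    using WP by (simp add: powerful_def closure_of_subtopology inf.absorb2 del: lower_p_series.simps)
qed

end

lemma pro_2_groupI:
  assumes "pro_p_group 2 G T"
  shows "pro_2_group G T"
  using assms
  by (simp add: pro_2_group_def pro_2_group_axioms_def profinite_def profinite_axioms_def
      top_group_def top_group_axioms_def pro_p_group_def profinite_group_def topological_group_def)

text \<open>The second part also records that P_n is a subgroup and, with the subspace topology, a
  pro-2 group, since \<open>powerful\<close> is meant for such groups.\<close>

theorem mainTheorem2:
  fixes H :: "('a, 'b) monoid_scheme" and T :: "'a topology" and n :: nat
  assumes "pro_p_group 2 H T" and "n \<ge> 1"
  shows "(powerful (H Mod nth_center H (n - 1)) (Mod_topology H T (nth_center H (n - 1))) \<longrightarrow>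
            powerfully_embedded (T closure_of (lower_central H n)) H T) \<and>
         (powerful (H Mod nth_center H (n - 1)) (Mod_topology H T (nth_center H (n - 1))) \<longrightarrow>
            (let P = lower_p_series 2 H T n; H\<^sub>P = H\<lparr>carrier := P\<rparr>; T\<^sub>P = subtopology T P
             in subgroup P H \<and> pro_p_group 2 H\<^sub>P T\<^sub>P \<and> powerful H\<^sub>P T\<^sub>P))"
proof -
  interpret pro_2_group H T by (rule pro_2_groupI[OF assms(1)])
  obtain i where n: "n = Suc i" using assms(2) by (cases n) auto
  show ?thesis
    unfolding n diff_Suc_1 Let_def
    using closure_lower_central_powerfully_embedded lower_2_series_powerful subgroup_lower_2_series
      pro_p_closed_subgroup[OF pro_2 subgroup_lower_2_series closed_lower_2_series]
    by blast
qed

end
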